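(* Let $(\mathcal{L},\mathcal{R})$ be an orthogonal factorisation system on a category $\mathcal{E}$ with pullbacks and finite products. Let $\mathcal{L}'$ be the class of internal functors $f$ in $\mathcal{E}$ that are $\mathcal{L}$-on-objects (i.e. $f_0\in\mathcal{L}$), and let $\mathcal{R}'$ be the class of internal functors that are $\mathcal{R}$-on-objects (i.e. $f_0\in\mathcal{R}$) and fully faithful. Then $(\mathcal{L}',\mathcal{R}')$ is an orthogonal factorisation system on the $2$-category $\mathbf{Cat}(\mathcal{E})$.
   Context: $\mathbf{Cat}(\mathcal{E})$ is the $2$-category of categories, functors and natural transformations internal to $\mathcal{E}$. An internal functor $f:\mathbb{A}\to\mathbb{B}$ has components $f_0:A_0\to B_0$ on objects and $f_1:A_1\to B_1$ on arrows; with $d_0,d_1$ the target and source maps, $f$ is fully faithful if the square with sides $f_1$, $(d_0,d_1):A_1\to A_0\times A_0$, $(d_0,d_1):B_1\to B_0\times B_0$, $f_0\times f_0$ is a pullback. For morphisms $s:A\to B$, $f:X\to Y$ in a $2$-category write $s\perp f$ if (i) for all $p:A\to X$, $q:B\to Y$ with $fp=qs$ there is a unique $u:B\to X$ with $fu=q$, $us=p$; and (ii) for all $2$-cells $\alpha:p\Rightarrow p'$, $\beta:q\Rightarrow q'$ with $fp=qs$, $fp'=q's$, $f\alpha=\beta s$, and induced $u,u'$, there is a unique $2$-cell $\gamma:u\Rightarrow u'$ with $f\gamma=\beta$, $\gamma s=\alpha$. An orthogonal factorisation system on a $2$-category is a pair $(\mathcal{L}',\mathcal{R}')$ of classes of morphisms,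 each containing the isomorphisms and closed under composition, such that $s\perp f$ for all $s\in\mathcal{L}'$, $f\in\mathcal{R}'$, and every morphism factors as $rl$ with $l\in\mathcal{L}'$, $r\in\mathcal{R}'$. *)

theory Defs
  imports Main
begin

section \<open>Categories\<close>

text \<open>Composition is in applicative order and is meaningful only on composable arrows;
  nothing is assumed about its value elsewhere.\<close>

record ('o, 'a) cat =
  Obj :: "'o set"
  Arr :: "'a set"
  Dom :: "'a \<Rightarrow> 'o"
  Cod :: "'a \<Rightarrow> 'o"
  Idn :: "'o \<Rightarrow> 'a"
  Cmp :: "'a \<Rightarrow> 'a \<Rightarrow> 'a"  (infixr "\<cdot>\<index>" 70)

definition hom :: "('o, 'a) cat \<Rightarrow> 'o \<Rightarrow> 'o \<Rightarrow> 'a set" where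
  "hom C A B = {f \<in> Arr C. Dom C f = A \<and> Cod C f = B}"

locale category =
  fixes C :: "('o, 'a) cat" (structure)
  assumes dom_obj: "f \<in> Arr C \<Longrightarrow> Dom C f \<in> Obj C"
    and cod_obj: "f \<in> Arr C \<Longrightarrow> Cod C f \<in> Obj C"
    and idn_hom: "A \<in> Obj C \<Longrightarrow> Idn C A \<in> hom C A A"
    and cmp_hom: "\<lbrakk>f \<in> hom C X Y; g \<in> hom C Y Z\<rbrakk> \<Longrightarrow> g \<cdot> f \<in> hom C X Z"
    and cmp_idn_left: "f \<in> hom C X Y \<Longrightarrow> Idn C Y \<cdot> f = f"
    and cmp_idn_right: "f \<in> hom C X Y \<Longrightarrow> f \<cdot> Idn C X = f"
    and cmp_assoc: "\<lbrakk>f \<in> hom C W X; g \<in> hom C X Y; h \<in> hom C Y Z\<rbrakk>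
      \<Longrightarrow> (h \<cdot> g) \<cdot> f = h \<cdot> (g \<cdot> f)"

definition is_iso :: "('o, 'a) cat \<Rightarrow> 'a \<Rightarrow> bool" where
  "is_iso C f \<longleftrightarrow> f \<in> Arr C \<and>
     (\<exists>g \<in> hom C (Cod C f) (Dom C f).
        g \<cdot>\<^bsub>C\<^esub> f = Idn C (Dom C f) \<and> f \<cdot>\<^bsub>C\<^esub> g = Idn C (Cod C f))"


section \<open>Finite products and pullbacks\<close>

definition is_product :: "('o, 'a) cat \<Rightarrow> 'i set \<Rightarrow> ('i \<Rightarrow> 'o) \<Rightarrow> 'o \<Rightarrow> ('i \<Rightarrow> 'a) \<Rightarrow> bool" where
  "is_product C I X P \<pi> \<longleftrightarrow> P \<in> Obj C \<and> (\<forall>i\<in>I. \<pi> i \<in> hom C P (X i)) \<and>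
     (\<forall>T\<in>Obj C. \<forall>f. (\<forall>i\<in>I. f i \<in> hom C T (X i)) \<longrightarrow>
        (\<exists>!u. u \<in> hom C T P \<and> (\<forall>i\<in>I. \<pi> i \<cdot>\<^bsub>C\<^esub> u = f i)))"

definition has_finite_products :: "('o, 'a) cat \<Rightarrow> bool" where
  "has_finite_products C \<longleftrightarrow>
     (\<forall>(n::nat) X. (\<forall>i<n. X i \<in> Obj C) \<longrightarrow> (\<exists>P \<pi>. is_product C {..<n} X P \<pi>))"

text \<open>\<open>is_pullback C f g p q\<close>: \<open>p\<close> and \<open>q\<close> are the projections of a pullback of the cospan
  \<open>(f, g)\<close>, with \<open>f \<cdot> p = g \<cdot> q\<close>.\<close>

definition is_pullback :: "('o, 'a) cat \<Rightarrow> 'a \<Rightarrow> 'a \<Rightarrow> 'a \<Rightarrow> 'a \<Rightarrow> bool" where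
  "is_pullback C f g p q \<longleftrightarrow> f \<in> Arr C \<and> g \<in> Arr C \<and> p \<in> Arr C \<and> q \<in> Arr C \<and>
     Cod C f = Cod C g \<and> Cod C p = Dom C f \<and> Cod C q = Dom C g \<and> Dom C p = Dom C q \<and>
     f \<cdot>\<^bsub>C\<^esub> p = g \<cdot>\<^bsub>C\<^esub> q \<and>
     (\<forall>T\<in>Obj C. \<forall>h \<in> hom C T (Dom C f). \<forall>k \<in> hom C T (Dom C g).
        f \<cdot>\<^bsub>C\<^esub> h = g \<cdot>\<^bsub>C\<^esub> k \<longrightarrow>
        (\<exists>!u. u \<in> hom C T (Dom C p) \<and> p \<cdot>\<^bsub>C\<^esub> u = h \<and> q \<cdot>\<^bsub>C\<^esub> u = k))"

definition has_pullbacks :: "('o, 'a) cat \<Rightarrow> bool" where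
  "has_pullbacks C \<longleftrightarrow>
     (\<forall>f\<in>Arr C. \<forall>g\<in>Arr C. Cod C f = Cod C g \<longrightarrow> (\<exists>p q. is_pullback C f g p q))"

text \<open>Chosen pullbacks and chosen binary products, with the arrows they induce. They are only
  meaningful when the limit in question exists and, for \<open>pb_pair\<close>, when \<open>f \<cdot> h = g \<cdot> k\<close>.\<close>

definition pb_cone :: "('o, 'a) cat \<Rightarrow> 'a \<Rightarrow> 'a \<Rightarrow> 'a \<times> 'a" where
  "pb_cone C f g = (SOME (p, q). is_pullback C f g p q)"

definition pb1 :: "('o, 'a) cat \<Rightarrow> 'a \<Rightarrow> 'a \<Rightarrow> 'a" where
  "pb1 C f g = fst (pb_cone C f g)"

definition pb2 :: "('o, 'a) cat \<Rightarrow> 'a \<Rightarrow> 'a \<Rightarrow> 'a" where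
  "pb2 C f g = snd (pb_cone C f g)"

definition pb_obj :: "('o, 'a) cat \<Rightarrow> 'a \<Rightarrow> 'a \<Rightarrow> 'o" where
  "pb_obj C f g = Dom C (pb1 C f g)"

definition pb_pair :: "('o, 'a) cat \<Rightarrow> 'a \<Rightarrow> 'a \<Rightarrow> 'a \<Rightarrow> 'a \<Rightarrow> 'a" where
  "pb_pair C f g h k = (THE u. u \<in> hom C (Dom C h) (pb_obj C f g) \<and>
     pb1 C f g \<cdot>\<^bsub>C\<^esub> u = h \<and> pb2 C f g \<cdot>\<^bsub>C\<^esub> u = k)"

definition pr_cone :: "('o, 'a) cat \<Rightarrow> 'o \<Rightarrow> 'o \<Rightarrow> 'o \<times> (nat \<Rightarrow> 'a)" where
  "pr_cone C A B = (SOME (P, \<pi>). is_product C {..<2} (\<lambda>i. if i = 0 then A else B) P \<pi>)"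

definition pr_obj :: "('o, 'a) cat \<Rightarrow> 'o \<Rightarrow> 'o \<Rightarrow> 'o" where
  "pr_obj C A B = fst (pr_cone C A B)"

definition pr1 :: "('o, 'a) cat \<Rightarrow> 'o \<Rightarrow> 'o \<Rightarrow> 'a" where
  "pr1 C A B = snd (pr_cone C A B) 0"

definition pr2 :: "('o, 'a) cat \<Rightarrow> 'o \<Rightarrow> 'o \<Rightarrow> 'a" where
  "pr2 C A B = snd (pr_cone C A B) 1"

definition pr_pair :: "('o, 'a) cat \<Rightarrow> 'a \<Rightarrow> 'a \<Rightarrow> 'a" where
  "pr_pair C h k = (THE u. u \<in> hom C (Dom C h) (pr_obj C (Cod C h) (Cod C k)) \<and>
     pr1 C (Cod C h) (Cod C k) \<cdot>\<^bsub>C\<^esub> u = h \<and> pr2 C (Cod C h) (Cod C k) \<cdot>\<^bsub>C\<^esub> u = k)"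

definition pr_map :: "('o, 'a) cat \<Rightarrow> 'a \<Rightarrow> 'a \<Rightarrow> 'a" where
  "pr_map C f g = pr_pair C (f \<cdot>\<^bsub>C\<^esub> pr1 C (Dom C f) (Dom C g)) (g \<cdot>\<^bsub>C\<^esub> pr2 C (Dom C f) (Dom C g))"


section \<open>Orthogonal factorisation systems on a category\<close>

definition orthogonal :: "('o, 'a) cat \<Rightarrow> 'a \<Rightarrow> 'a \<Rightarrow> bool" where
  "orthogonal C s f \<longleftrightarrow>
     (\<forall>p \<in> hom C (Dom C s) (Dom C f). \<forall>q \<in> hom C (Cod C s) (Cod C f).
        f \<cdot>\<^bsub>C\<^esub> p = q \<cdot>\<^bsub>C\<^esub> s \<longrightarrow>
        (\<exists>!u. u \<in> hom C (Cod C s) (Dom C f) \<and> f \<cdot>\<^bsub>C\<^esub> u = q \<and> u \<cdot>\<^bsub>C\<^esub> s = p))"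

definition contains_isos :: "('o, 'a) cat \<Rightarrow> 'a set \<Rightarrow> bool" where
  "contains_isos C S \<longleftrightarrow> (\<forall>f. is_iso C f \<longrightarrow> f \<in> S)"

definition closed_under_comp :: "('o, 'a) cat \<Rightarrow> 'a set \<Rightarrow> bool" where
  "closed_under_comp C S \<longleftrightarrow> (\<forall>f\<in>S. \<forall>g\<in>S. Cod C f = Dom C g \<longrightarrow> g \<cdot>\<^bsub>C\<^esub> f \<in> S)"

definition has_factorisations :: "('o, 'a) cat \<Rightarrow> 'a set \<Rightarrow> 'a set \<Rightarrow> bool" where
  "has_factorisations C L R \<longleftrightarrow>
     (\<forall>f\<in>Arr C. \<exists>l\<in>L. \<exists>r\<in>R. Dom C l = Dom C f \<and> Cod C l = Dom C r \<and> Cod C r = Cod C f \<and>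
        f = r \<cdot>\<^bsub>C\<^esub> l)"

locale orthogonal_factorisation_system = category C
  for C :: "('o, 'a) cat" and L R :: "'a set" +
  assumes L_arr: "L \<subseteq> Arr C" and R_arr: "R \<subseteq> Arr C"
    and L_isos: "contains_isos C L" and R_isos: "contains_isos C R"
    and L_comp: "closed_under_comp C L" and R_comp: "closed_under_comp C R"
    and orth: "\<lbrakk>s \<in> L; f \<in> R\<rbrakk> \<Longrightarrow> orthogonal C s f"
    and factorisation: "has_factorisations C L R"


section \<open>Strict 2-categories and their orthogonal factorisation systems\<close>

text \<open>A 2-category is given by its underlying category \<open>One\<close> of 0-cells and 1-cells, the category
  \<open>Vert\<close> of 1-cells and 2-cells under vertical composition, and horizontal composition of 2-cells.
  Horizontal composition has to make \<open>horiz\<close> (0-cells and 2-cells) a category too.\<close>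

record ('o, 'f, 't) two_cat =
  One :: "('o, 'f) cat"
  Vert :: "('f, 't) cat"
  HCmp :: "'t \<Rightarrow> 't \<Rightarrow> 't"  (infixr "\<star>\<index>" 70)

definition horiz :: "('o, 'f, 't) two_cat \<Rightarrow> ('o, 't) cat" where
  "horiz K = \<lparr>
     Obj = Obj (One K),
     Arr = Arr (Vert K),
     Dom = (\<lambda>\<alpha>. Dom (One K) (Dom (Vert K) \<alpha>)),
     Cod = (\<lambda>\<alpha>. Cod (One K) (Dom (Vert K) \<alpha>)),
     Idn = (\<lambda>A. Idn (Vert K) (Idn (One K) A)),
     Cmp = HCmp K \<rparr>"

locale two_category =
  fixes K :: "('o, 'f, 't) two_cat" (structure)
  assumes one_category: "category (One K)"
    and vert_category: "category (Vert K)"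
    and horiz_category: "category (horiz K)"
    and vert_obj: "Obj (Vert K) = Arr (One K)"
    and parallel: "\<alpha> \<in> Arr (Vert K) \<Longrightarrow>
      Dom (One K) (Cod (Vert K) \<alpha>) = Dom (One K) (Dom (Vert K) \<alpha>) \<and>
      Cod (One K) (Cod (Vert K) \<alpha>) = Cod (One K) (Dom (Vert K) \<alpha>)"
    and hcmp_hom: "\<lbrakk>\<alpha> \<in> hom (Vert K) f f'; \<beta> \<in> hom (Vert K) g g'; Cod (One K) f = Dom (One K) g\<rbrakk>
      \<Longrightarrow> \<beta> \<star> \<alpha> \<in> hom (Vert K) (g \<cdot>\<^bsub>One K\<^esub> f) (g' \<cdot>\<^bsub>One K\<^esub> f')"
    and hcmp_idn: "\<lbrakk>f \<in> Arr (One K); g \<in> Arr (One K); Cod (One K) f = Dom (One K) g\<rbrakk>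
      \<Longrightarrow> Idn (Vert K) g \<star> Idn (Vert K) f = Idn (Vert K) (g \<cdot>\<^bsub>One K\<^esub> f)"
    and interchange: "\<lbrakk>\<alpha> \<in> hom (Vert K) f f'; \<alpha>' \<in> hom (Vert K) f' f'';
        \<beta> \<in> hom (Vert K) g g'; \<beta>' \<in> hom (Vert K) g' g''; Cod (One K) f = Dom (One K) g\<rbrakk>
      \<Longrightarrow> (\<beta>' \<cdot>\<^bsub>Vert K\<^esub> \<beta>) \<star> (\<alpha>' \<cdot>\<^bsub>Vert K\<^esub> \<alpha>) = (\<beta>' \<star> \<alpha>') \<cdot>\<^bsub>Vert K\<^esub> (\<beta> \<star> \<alpha>)"

definition whisker_left :: "('o, 'f, 't) two_cat \<Rightarrow> 'f \<Rightarrow> 't \<Rightarrow> 't" where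
  "whisker_left K f \<alpha> = Idn (Vert K) f \<star>\<^bsub>K\<^esub> \<alpha>"

definition whisker_right :: "('o, 'f, 't) two_cat \<Rightarrow> 't \<Rightarrow> 'f \<Rightarrow> 't" where
  "whisker_right K \<alpha> f = \<alpha> \<star>\<^bsub>K\<^esub> Idn (Vert K) f"

definition two_orthogonal :: "('o, 'f, 't) two_cat \<Rightarrow> 'f \<Rightarrow> 'f \<Rightarrow> bool" where
  "two_orthogonal K s f \<longleftrightarrow>
     orthogonal (One K) s f \<and>
     (let A = Dom (One K) s; B = Cod (One K) s; X = Dom (One K) f; Y = Cod (One K) f in
      \<forall>p \<in> hom (One K) A X. \<forall>p' \<in> hom (One K) A X. \<forall>q \<in> hom (One K) B Y. \<forall>q' \<in> hom (One K) B Y.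
      \<forall>\<alpha> \<in> hom (Vert K) p p'. \<forall>\<beta> \<in> hom (Vert K) q q'.
        f \<cdot>\<^bsub>One K\<^esub> p = q \<cdot>\<^bsub>One K\<^esub> s \<and> f \<cdot>\<^bsub>One K\<^esub> p' = q' \<cdot>\<^bsub>One K\<^esub> s \<and>
        whisker_left K f \<alpha> = whisker_right K \<beta> s \<longrightarrow>
        (\<forall>u \<in> hom (One K) B X. \<forall>u' \<in> hom (One K) B X.
           f \<cdot>\<^bsub>One K\<^esub> u = q \<and> u \<cdot>\<^bsub>One K\<^esub> s = p \<and> f \<cdot>\<^bsub>One K\<^esub> u' = q' \<and> u' \<cdot>\<^bsub>One K\<^esub> s = p' \<longrightarrow>
           (\<exists>!\<gamma>. \<gamma> \<in> hom (Vert K) u u' \<and>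
              whisker_left K f \<gamma> = \<beta> \<and> whisker_right K \<gamma> s = \<alpha>)))"

locale two_orthogonal_factorisation_system = two_category K
  for K :: "('o, 'f, 't) two_cat" and L R :: "'f set" +
  assumes L_arr: "L \<subseteq> Arr (One K)" and R_arr: "R \<subseteq> Arr (One K)"
    and L_isos: "contains_isos (One K) L" and R_isos: "contains_isos (One K) R"
    and L_comp: "closed_under_comp (One K) L" and R_comp: "closed_under_comp (One K) R"
    and orth: "\<lbrakk>s \<in> L; f \<in> R\<rbrakk> \<Longrightarrow> two_orthogonal K s f"
    and factorisation: "has_factorisations (One K) L R"


section \<open>Internal categories, functors and natural transformations\<close>

text \<open>\<open>d0\<close> is the target and \<open>d1\<close> the source map. The object of composable pairs \<open>(g, f)\<close>, with
  \<open>g\<close> after \<open>f\<close>, is the chosen pullback of \<open>d1\<close> (applied to \<open>g\<close>) and \<open>d0\<close> (applied to \<open>f\<close>).\<close>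

record ('o, 'a) icat =
  ob :: 'o
  ar :: 'o
  d0 :: 'a
  d1 :: 'a
  idm :: 'a
  mul :: 'a

text \<open>Composite of two arrows of an internal category, as generalised elements \<open>g, f : T \<rightarrow> A\<^sub>1\<close>
  with \<open>d1 \<cdot> g = d0 \<cdot> f\<close>.\<close>

definition icmp :: "('o, 'a) cat \<Rightarrow> ('o, 'a) icat \<Rightarrow> 'a \<Rightarrow> 'a \<Rightarrow> 'a" where
  "icmp E A g f = mul A \<cdot>\<^bsub>E\<^esub> pb_pair E (d1 A) (d0 A) g f"

text \<open>In the associativity law, \<open>r\<close> and \<open>t\<close> are the projections to \<open>A\<^sub>2\<close> and \<open>A\<^sub>1\<close> of the object of
  composable triples \<open>A\<^sub>2 \<times> A\<^sub>1\<close>, the fibre product being over \<open>A\<^sub>0\<close>.\<close>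

definition internal_category :: "('o, 'a) cat \<Rightarrow> ('o, 'a) icat \<Rightarrow> bool" where
  "internal_category E A \<longleftrightarrow>
     ob A \<in> Obj E \<and> ar A \<in> Obj E \<and>
     d0 A \<in> hom E (ar A) (ob A) \<and> d1 A \<in> hom E (ar A) (ob A) \<and>
     idm A \<in> hom E (ob A) (ar A) \<and>
     mul A \<in> hom E (pb_obj E (d1 A) (d0 A)) (ar A) \<and>
     d0 A \<cdot>\<^bsub>E\<^esub> idm A = Idn E (ob A) \<and>
     d1 A \<cdot>\<^bsub>E\<^esub> idm A = Idn E (ob A) \<and>
     (let \<pi>1 = pb1 E (d1 A) (d0 A); \<pi>2 = pb2 E (d1 A) (d0 A);
          r = pb1 E (d1 A \<cdot>\<^bsub>E\<^esub> \<pi>2) (d0 A); t = pb2 E (d1 A \<cdot>\<^bsub>E\<^esub> \<pi>2) (d0 A) in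
      d0 A \<cdot>\<^bsub>E\<^esub> mul A = d0 A \<cdot>\<^bsub>E\<^esub> \<pi>1 \<and>
      d1 A \<cdot>\<^bsub>E\<^esub> mul A = d1 A \<cdot>\<^bsub>E\<^esub> \<pi>2 \<and>
      icmp E A (idm A \<cdot>\<^bsub>E\<^esub> d0 A) (Idn E (ar A)) = Idn E (ar A) \<and>
      icmp E A (Idn E (ar A)) (idm A \<cdot>\<^bsub>E\<^esub> d1 A) = Idn E (ar A) \<and>
      icmp E A (mul A \<cdot>\<^bsub>E\<^esub> r) t = icmp E A (\<pi>1 \<cdot>\<^bsub>E\<^esub> r) (icmp E A (\<pi>2 \<cdot>\<^bsub>E\<^esub> r) t))"

record ('o, 'a) ifun =
  fdom :: "('o, 'a) icat"
  fcod :: "('o, 'a) icat"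
  fob :: 'a
  far :: 'a

definition internal_functor :: "('o, 'a) cat \<Rightarrow> ('o, 'a) ifun \<Rightarrow> bool" where
  "internal_functor E f \<longleftrightarrow>
     (let A = fdom f; B = fcod f in
      internal_category E A \<and> internal_category E B \<and>
      fob f \<in> hom E (ob A) (ob B) \<and> far f \<in> hom E (ar A) (ar B) \<and>
      d0 B \<cdot>\<^bsub>E\<^esub> far f = fob f \<cdot>\<^bsub>E\<^esub> d0 A \<and>
      d1 B \<cdot>\<^bsub>E\<^esub> far f = fob f \<cdot>\<^bsub>E\<^esub> d1 A \<and>
      far f \<cdot>\<^bsub>E\<^esub> idm A = idm B \<cdot>\<^bsub>E\<^esub> fob f \<and>
      far f \<cdot>\<^bsub>E\<^esub> mul A =
        icmp E B (far f \<cdot>\<^bsub>E\<^esub> pb1 E (d1 A) (d0 A)) (far f \<cdot>\<^bsub>E\<^esub> pb2 E (d1 A) (d0 A)))"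

definition ifun_id :: "('o, 'a) cat \<Rightarrow> ('o, 'a) icat \<Rightarrow> ('o, 'a) ifun" where
  "ifun_id E A = \<lparr> fdom = A, fcod = A, fob = Idn E (ob A), far = Idn E (ar A) \<rparr>"

definition ifun_cmp :: "('o, 'a) cat \<Rightarrow> ('o, 'a) ifun \<Rightarrow> ('o, 'a) ifun \<Rightarrow> ('o, 'a) ifun" where
  "ifun_cmp E g f = \<lparr> fdom = fdom f, fcod = fcod g,
     fob = fob g \<cdot>\<^bsub>E\<^esub> fob f, far = far g \<cdot>\<^bsub>E\<^esub> far f \<rparr>"

record ('o, 'a) inat =
  ndom :: "('o, 'a) ifun"
  ncod :: "('o, 'a) ifun"
  ncom :: 'a

definition internal_nat :: "('o, 'a) cat \<Rightarrow> ('o, 'a) inat \<Rightarrow> bool" where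
  "internal_nat E \<alpha> \<longleftrightarrow>
     (let f = ndom \<alpha>; g = ncod \<alpha>; A = fdom f; B = fcod f in
      internal_functor E f \<and> internal_functor E g \<and> fdom g = A \<and> fcod g = B \<and>
      ncom \<alpha> \<in> hom E (ob A) (ar B) \<and>
      d1 B \<cdot>\<^bsub>E\<^esub> ncom \<alpha> = fob f \<and>
      d0 B \<cdot>\<^bsub>E\<^esub> ncom \<alpha> = fob g \<and>
      icmp E B (ncom \<alpha> \<cdot>\<^bsub>E\<^esub> d0 A) (far f) = icmp E B (far g) (ncom \<alpha> \<cdot>\<^bsub>E\<^esub> d1 A))"

definition inat_id :: "('o, 'a) cat \<Rightarrow> ('o, 'a) ifun \<Rightarrow> ('o, 'a) inat" where
  "inat_id E f = \<lparr> ndom = f, ncod = f, ncom = idm (fcod f) \<cdot>\<^bsub>E\<^esub> fob f \<rparr>"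

definition inat_vcmp :: "('o, 'a) cat \<Rightarrow> ('o, 'a) inat \<Rightarrow> ('o, 'a) inat \<Rightarrow> ('o, 'a) inat" where
  "inat_vcmp E \<beta> \<alpha> = \<lparr> ndom = ndom \<alpha>, ncod = ncod \<beta>,
     ncom = icmp E (fcod (ndom \<alpha>)) (ncom \<beta>) (ncom \<alpha>) \<rparr>"

text \<open>For \<open>\<alpha> : f \<Rightarrow> f'\<close> and \<open>\<beta> : g \<Rightarrow> g'\<close>, the component of the horizontal composite at \<open>a\<close> is
  \<open>\<beta>\<close> at \<open>f' a\<close> after \<open>g\<close> applied to the component of \<open>\<alpha>\<close> at \<open>a\<close>.\<close>

definition inat_hcmp :: "('o, 'a) cat \<Rightarrow> ('o, 'a) inat \<Rightarrow> ('o, 'a) inat \<Rightarrow> ('o, 'a) inat" where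
  "inat_hcmp E \<beta> \<alpha> = \<lparr> ndom = ifun_cmp E (ndom \<beta>) (ndom \<alpha>), ncod = ifun_cmp E (ncod \<beta>) (ncod \<alpha>),
     ncom = icmp E (fcod (ndom \<beta>)) (ncom \<beta> \<cdot>\<^bsub>E\<^esub> fob (ncod \<alpha>)) (far (ndom \<beta>) \<cdot>\<^bsub>E\<^esub> ncom \<alpha>) \<rparr>"

definition Cat :: "('o, 'a) cat \<Rightarrow> (('o, 'a) icat, ('o, 'a) ifun, ('o, 'a) inat) two_cat" where
  "Cat E = \<lparr>
     One = \<lparr> Obj = {A. internal_category E A}, Arr = {f. internal_functor E f},
             Dom = fdom, Cod = fcod, Idn = ifun_id E, Cmp = ifun_cmp E \<rparr>,
     Vert = \<lparr> Obj = {f. internal_functor E f}, Arr = {\<alpha>. internal_nat E \<alpha>},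
              Dom = ndom, Cod = ncod, Idn = inat_id E, Cmp = inat_vcmp E \<rparr>,
     HCmp = inat_hcmp E \<rparr>"

definition fully_faithful :: "('o, 'a) cat \<Rightarrow> ('o, 'a) ifun \<Rightarrow> bool" where
  "fully_faithful E f \<longleftrightarrow>
     is_pullback E (pr_pair E (d0 (fcod f)) (d1 (fcod f))) (pr_map E (fob f) (fob f))
       (far f) (pr_pair E (d0 (fdom f)) (d1 (fdom f)))"

definition on_objects :: "('o, 'a) cat \<Rightarrow> 'a set \<Rightarrow> ('o, 'a) ifun set" where
  "on_objects E S = {f. internal_functor E f \<and> fob f \<in> S}"

end

theory Submission
  imports Defs
begin

text \<open>An internal category is handled through its generalised elements, on which \<open>icmp\<close> is an
  honest partial composition stable under precomposition. Full faithfulness of \<open>f\<close> then says that a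
  generalised arrow of the domain amounts to its two end points together with its image under \<open>f\<close>.
  Consequently diagonal functors and 2-cells are determined by, and can be lifted from, their
  underlying data on objects, where orthogonality in \<open>E\<close> applies. To factorise \<open>f\<close>, factorise
  \<open>fob f = r0 \<cdot> l0\<close> and take the full image of \<open>r0\<close> in the codomain; the arrow part of the left
  factor is again a lift along a fully faithful functor.\<close>

section \<open>Arrows, pullbacks and binary products\<close>

text \<open>The axioms speak of universal elements only: projections of chosen pullbacks of
  composable pairs or triples, and the identity of the object of arrows. Every composable tuple of
  generalised elements factors through the universal one, so precomposition turns each axiom into an
  equation between arbitrary generalised elements. What remains is ordinary category theory with
  typing conditions, because \<open>icmp\<close> means nothing on non-composable arguments.

  Full faithfulness then works twice. Existence supplies an arrow with prescribed ends over a given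
  arrow. Joint monicity of \<open>far f\<close>, \<open>d0\<close> and \<open>d1\<close> proves the
  equations this arrow must satisfy: they hold after applying \<open>far f\<close>, and the ends
  agree. Functor laws, naturality and uniqueness of diagonals all come from this one argument, and
  so do the category laws of a full image, where it has to be run before any functor is
  available.\<close>

context category
begin

lemma cmp_arr [simp]:
  assumes "f \<in> Arr C" "g \<in> Arr C" "Cod C f = Dom C g"
  shows "g \<cdot> f \<in> Arr C" "Dom C (g \<cdot> f) = Dom C f" "Cod C (g \<cdot> f) = Cod C g"
  using cmp_hom[of f "Dom C f" "Cod C f" g "Cod C g"] assms by (auto simp: hom_def)

lemma cmp_assoc_arr [simp]:
  assumes "f \<in> Arr C" "g \<in> Arr C" "h \<in> Arr C" "Cod C f = Dom C g" "Cod C g = Dom C h"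
  shows "(h \<cdot> g) \<cdot> f = h \<cdot> (g \<cdot> f)"
  using cmp_assoc[of f "Dom C f" "Cod C f" g "Cod C g" h "Cod C h"] assms by (auto simp: hom_def)

lemma idn_arr [simp]:
  assumes "X \<in> Obj C"
  shows "Idn C X \<in> Arr C" "Dom C (Idn C X) = X" "Cod C (Idn C X) = X"
  using idn_hom[of X] assms by (auto simp: hom_def)

lemma cmp_idn [simp]:
  assumes "f \<in> Arr C"
  shows "Cod C f = X \<Longrightarrow> Idn C X \<cdot> f = f" "Dom C f = X \<Longrightarrow> f \<cdot> Idn C X = f"
  using cmp_idn_left[of f "Dom C f" X] cmp_idn_right[of f X "Cod C f"] assms
  by (auto simp: hom_def)

lemma dom_cod_obj [simp]:
  assumes "f \<in> Arr C"
  shows "Dom C f \<in> Obj C" "Cod C f \<in> Obj C"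
  using assms by (auto intro: dom_obj cod_obj)

text \<open>The simplifier associates composites to the right, so a rule with left side
  \<open>f \<cdot> g\<close> no longer matches inside \<open>f \<cdot> (g \<cdot> x)\<close>. This
  produces the companion rule with a trailing \<open>x\<close>; the later lemmas ending in
  \<open>_cmp\<close> are mostly of this kind.\<close>

lemma cmp_reassoc:
  assumes "f \<cdot> g = h" "g \<in> Arr C" "f \<in> Arr C" "Cod C g = Dom C f"
    and "x \<in> Arr C" "Cod C x = Dom C g"
  shows "f \<cdot> (g \<cdot> x) = h \<cdot> x"
  using assms by (metis cmp_assoc_arr)

end

locale category_with_limits = category E for E :: "('o, 'a) cat" (structure) +
  assumes pullbacks: "has_pullbacks E" and products: "has_finite_products E"
begin

lemma is_pullback_pb:
  assumes "f \<in> Arr E" "g \<in> Arr E" "Cod E f = Cod E g"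
  shows "is_pullback E f g (pb1 E f g) (pb2 E f g)"
proof -
  have "\<exists>c. case c of (p, q) \<Rightarrow> is_pullback E f g p q"
    using pullbacks assms by (auto simp: has_pullbacks_def)
  from someI_ex[OF this] show ?thesis
    unfolding pb1_def pb2_def pb_cone_def case_prod_beta .
qed

lemma pb_arr:
  assumes "f \<in> Arr E" "g \<in> Arr E" "Cod E f = Cod E g"
  shows "pb1 E f g \<in> Arr E" "pb2 E f g \<in> Arr E"
    "Dom E (pb1 E f g) = pb_obj E f g" "Dom E (pb2 E f g) = pb_obj E f g"
    "Cod E (pb1 E f g) = Dom E f" "Cod E (pb2 E f g) = Dom E g"
    "f \<cdot> pb1 E f g = g \<cdot> pb2 E f g" "pb_obj E f g \<in> Obj E"
  using is_pullback_pb[OF assms] dom_obj by (auto simp: is_pullback_def pb_obj_def)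

lemma pb_pair_ex1:
  assumes "f \<in> Arr E" "g \<in> Arr E" "Cod E f = Cod E g"
    and "h \<in> Arr E" "k \<in> Arr E" "Cod E h = Dom E f" "Cod E k = Dom E g" "Dom E h = Dom E k"
    and "f \<cdot> h = g \<cdot> k"
  shows "\<exists>!u. u \<in> hom E (Dom E h) (pb_obj E f g) \<and> pb1 E f g \<cdot> u = h \<and> pb2 E f g \<cdot> u = k"
proof -
  have "\<forall>T\<in>Obj E. \<forall>h \<in> hom E T (Dom E f). \<forall>k \<in> hom E T (Dom E g). f \<cdot> h = g \<cdot> k \<longrightarrow>
      (\<exists>!u. u \<in> hom E T (Dom E (pb1 E f g)) \<and> pb1 E f g \<cdot> u = h \<and> pb2 E f g \<cdot> u = k)"
    using is_pullback_pb[OF assms(1-3)] unfolding is_pullback_def by blast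
  from this[rule_format, of "Dom E h" h k] show ?thesis
    using assms(4-) by (simp add: pb_obj_def hom_def)
qed

lemma pb_pair_arr:
  assumes "f \<in> Arr E" "g \<in> Arr E" "Cod E f = Cod E g"
    and "h \<in> Arr E" "k \<in> Arr E" "Cod E h = Dom E f" "Cod E k = Dom E g" "Dom E h = Dom E k"
    and "f \<cdot> h = g \<cdot> k"
  shows "pb_pair E f g h k \<in> Arr E" "Dom E (pb_pair E f g h k) = Dom E k"
    "Cod E (pb_pair E f g h k) = pb_obj E f g"
    "pb1 E f g \<cdot> pb_pair E f g h k = h" "pb2 E f g \<cdot> pb_pair E f g h k = k"
  using theI'[OF pb_pair_ex1[OF assms]] assms(8) by (auto simp: pb_pair_def hom_def)

text \<open>Compatibility of \<open>h\<close> and \<open>k\<close> is inherited from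
  \<open>u\<close>, so it need not be supplied by the caller.\<close>

lemma pb_pair_eqI:
  assumes "f \<in> Arr E" "g \<in> Arr E" "Cod E f = Cod E g"
    and "u \<in> Arr E" "Cod E u = pb_obj E f g" "pb1 E f g \<cdot> u = h" "pb2 E f g \<cdot> u = k"
  shows "pb_pair E f g h k = u"
proof -
  note [simp] = pb_arr[OF assms(1-3)] assms(1-5)
  have h: "h \<in> Arr E" "Dom E h = Dom E u" "Cod E h = Dom E f"
    and k: "k \<in> Arr E" "Dom E k = Dom E u" "Cod E k = Dom E g"
    using assms(6,7)[symmetric] by simp_all
  have "f \<cdot> h = (f \<cdot> pb1 E f g) \<cdot> u" using assms(6) by (simp del: pb_arr(7)[OF assms(1-3)])
  also have "\<dots> = g \<cdot> k" using assms(7) by simp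
  finally have "f \<cdot> h = g \<cdot> k" .
  then show ?thesis unfolding pb_pair_def
    using pb_pair_ex1[OF assms(1-3) h(1) k(1)] h k assms
    by (intro the1_equality) (auto simp: hom_def)
qed

section \<open>Chosen binary products and pairing\<close>

lemma is_product_pr:
  assumes "X \<in> Obj E" "Y \<in> Obj E"
  shows "is_product E {..<2} (\<lambda>i. if i = 0 then X else Y) (pr_obj E X Y) (snd (pr_cone E X Y))"
proof -
  have "\<exists>P \<pi>. is_product E {..<2::nat} (\<lambda>i. if i = 0 then X else Y) P \<pi>"
    using products[unfolded has_finite_products_def, rule_format, of 2 "\<lambda>i. if i = 0 then X else Y"] assms
    by simp
  then have "\<exists>c. case c of (P, \<pi>) \<Rightarrow> is_product E {..<2::nat} (\<lambda>i. if i = 0 then X else Y) P \<pi>"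
    by auto
  from someI_ex[OF this] show ?thesis
    unfolding pr_cone_def pr_obj_def case_prod_beta .
qed

lemma pr_arr [simp]:
  assumes "X \<in> Obj E" "Y \<in> Obj E"
  shows "pr1 E X Y \<in> Arr E" "pr2 E X Y \<in> Arr E"
    "Dom E (pr1 E X Y) = pr_obj E X Y" "Dom E (pr2 E X Y) = pr_obj E X Y"
    "Cod E (pr1 E X Y) = X" "Cod E (pr2 E X Y) = Y" "pr_obj E X Y \<in> Obj E"
  using is_product_pr[OF assms] by (auto simp: is_product_def pr1_def pr2_def hom_def)

lemma pr_pair_ex1:
  assumes "h \<in> Arr E" "k \<in> Arr E" "Dom E h = Dom E k"
  shows "\<exists>!u. u \<in> hom E (Dom E h) (pr_obj E (Cod E h) (Cod E k)) \<and>
    pr1 E (Cod E h) (Cod E k) \<cdot> u = h \<and> pr2 E (Cod E h) (Cod E k) \<cdot> u = k"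
proof -
  have less_2: "(\<forall>i\<in>{..<2::nat}. P i) \<longleftrightarrow> P 0 \<and> P 1" for P
    by (auto simp: less_2_cases_iff)
  let ?f = "\<lambda>i::nat. if i = 0 then h else k"
  have "\<forall>f. (\<forall>i\<in>{..<2}. f i \<in> hom E (Dom E h) (if i = 0 then Cod E h else Cod E k)) \<longrightarrow>
        (\<exists>!u. u \<in> hom E (Dom E h) (pr_obj E (Cod E h) (Cod E k)) \<and>
          (\<forall>i\<in>{..<2}. snd (pr_cone E (Cod E h) (Cod E k)) i \<cdot> u = f i))"
    using is_product_pr[of "Cod E h" "Cod E k"] assms dom_cod_obj
    unfolding is_product_def by blast
  from this[rule_format, of ?f] show ?thesis
    using assms by (simp add: less_2 pr1_def pr2_def hom_def)
qed

lemma pr_pair_arr [simp]: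
  assumes "h \<in> Arr E" "k \<in> Arr E" "Dom E h = Dom E k"
  shows "pr_pair E h k \<in> Arr E" "Dom E (pr_pair E h k) = Dom E k"
    "Cod E (pr_pair E h k) = pr_obj E (Cod E h) (Cod E k)"
    "Cod E h = X \<Longrightarrow> Cod E k = Y \<Longrightarrow> pr1 E X Y \<cdot> pr_pair E h k = h"
    "Cod E h = X \<Longrightarrow> Cod E k = Y \<Longrightarrow> pr2 E X Y \<cdot> pr_pair E h k = k"
  using theI'[OF pr_pair_ex1[OF assms]] assms(3) by (auto simp: pr_pair_def hom_def)

lemma pr_eqI:
  assumes "X \<in> Obj E" "Y \<in> Obj E"
    and "u \<in> Arr E" "v \<in> Arr E" "Dom E u = Dom E v"
    and "Cod E u = pr_obj E X Y" "Cod E v = pr_obj E X Y"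
    and "pr1 E X Y \<cdot> u = pr1 E X Y \<cdot> v" "pr2 E X Y \<cdot> u = pr2 E X Y \<cdot> v"
  shows "u = v"
  using pr_pair_ex1[of "pr1 E X Y \<cdot> u" "pr2 E X Y \<cdot> u"] assms by (auto simp: hom_def)

lemma pr_pair_cmp:
  assumes "h \<in> Arr E" "k \<in> Arr E" "Dom E h = Dom E k" "x \<in> Arr E" "Cod E x = Dom E k"
  shows "pr_pair E h k \<cdot> x = pr_pair E (h \<cdot> x) (k \<cdot> x)"
  using assms
  by - (rule pr_eqI[of "Cod E h" "Cod E k"], auto simp: cmp_reassoc[OF pr_pair_arr(4)] cmp_reassoc[OF pr_pair_arr(5)])

lemma pr_pair_eq_iff:
  assumes "h \<in> Arr E" "k \<in> Arr E" "Dom E h = Dom E k"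
    and "h' \<in> Arr E" "k' \<in> Arr E" "Dom E h' = Dom E k'" "Cod E h' = Cod E h" "Cod E k' = Cod E k"
  shows "pr_pair E h k = pr_pair E h' k' \<longleftrightarrow> h = h' \<and> k = k'"
  using pr_pair_arr(4,5)[OF assms(1-3) refl refl] pr_pair_arr(4,5)[OF assms(4-6) refl refl]
    assms(7,8) by auto

lemma pr_map_cmp_pair:
  assumes "f \<in> Arr E" "g \<in> Arr E" "x \<in> Arr E" "y \<in> Arr E"
    and "Cod E x = Dom E f" "Cod E y = Dom E g" "Dom E x = Dom E y"
  shows "pr_map E f g \<cdot> pr_pair E x y = pr_pair E (f \<cdot> x) (g \<cdot> y)"
  using assms by (simp add: pr_map_def pr_pair_cmp)

lemma pr_map_arr [simp]:
  assumes "f \<in> Arr E" "g \<in> Arr E"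
  shows "pr_map E f g \<in> Arr E" "Dom E (pr_map E f g) = pr_obj E (Dom E f) (Dom E g)"
    "Cod E (pr_map E f g) = pr_obj E (Cod E f) (Cod E g)"
  using assms by (simp_all add: pr_map_def)

lemma pr_pair_eta:
  assumes "X \<in> Obj E" "Y \<in> Obj E" "u \<in> Arr E" "Cod E u = pr_obj E X Y"
  shows "pr_pair E (pr1 E X Y \<cdot> u) (pr2 E X Y \<cdot> u) = u"
  using assms by - (rule pr_eqI[of X Y], auto)

section \<open>Internal categories through generalised elements\<close>

lemma icat_arr [simp]:
  assumes "internal_category E A"
  shows "ob A \<in> Obj E" "ar A \<in> Obj E"
    "d0 A \<in> Arr E" "Dom E (d0 A) = ar A" "Cod E (d0 A) = ob A"
    "d1 A \<in> Arr E" "Dom E (d1 A) = ar A" "Cod E (d1 A) = ob A"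
    "idm A \<in> Arr E" "Dom E (idm A) = ob A" "Cod E (idm A) = ar A"
    "mul A \<in> Arr E" "Dom E (mul A) = pb_obj E (d1 A) (d0 A)" "Cod E (mul A) = ar A"
    "d0 A \<cdot> idm A = Idn E (ob A)" "d1 A \<cdot> idm A = Idn E (ob A)"
  using assms by (auto simp: internal_category_def hom_def)

lemma icat_d_idm [simp]:
  assumes "internal_category E A" "x \<in> Arr E" "Cod E x = ob A"
  shows "d0 A \<cdot> (idm A \<cdot> x) = x" "d1 A \<cdot> (idm A \<cdot> x) = x"
  using assms by (simp_all add: cmp_reassoc[OF icat_arr(15)] cmp_reassoc[OF icat_arr(16)])

lemma icat_pb:
  assumes "internal_category E A"
  shows "pb1 E (d1 A) (d0 A) \<in> Arr E" "pb2 E (d1 A) (d0 A) \<in> Arr E"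
    "Dom E (pb1 E (d1 A) (d0 A)) = pb_obj E (d1 A) (d0 A)"
    "Dom E (pb2 E (d1 A) (d0 A)) = pb_obj E (d1 A) (d0 A)"
    "Cod E (pb1 E (d1 A) (d0 A)) = ar A" "Cod E (pb2 E (d1 A) (d0 A)) = ar A"
    "d1 A \<cdot> pb1 E (d1 A) (d0 A) = d0 A \<cdot> pb2 E (d1 A) (d0 A)"
    "pb_obj E (d1 A) (d0 A) \<in> Obj E"
  using pb_arr[of "d1 A" "d0 A"] assms by simp_all

lemma icat_pair:
  assumes "internal_category E A"
    and "g \<in> Arr E" "f \<in> Arr E" "Cod E g = ar A" "Cod E f = ar A" "Dom E g = Dom E f"
    and "d1 A \<cdot> g = d0 A \<cdot> f"
  shows "pb_pair E (d1 A) (d0 A) g f \<in> Arr E" "Dom E (pb_pair E (d1 A) (d0 A) g f) = Dom E f"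
    "Cod E (pb_pair E (d1 A) (d0 A) g f) = pb_obj E (d1 A) (d0 A)"
    "pb1 E (d1 A) (d0 A) \<cdot> pb_pair E (d1 A) (d0 A) g f = g"
    "pb2 E (d1 A) (d0 A) \<cdot> pb_pair E (d1 A) (d0 A) g f = f"
  using pb_pair_arr[of "d1 A" "d0 A" g f] assms by simp_all

lemma icmp_arr [simp]:
  assumes A: "internal_category E A"
    and c: "g \<in> Arr E" "f \<in> Arr E" "Cod E g = ar A" "Cod E f = ar A" "Dom E g = Dom E f"
      "d1 A \<cdot> g = d0 A \<cdot> f"
  shows "icmp E A g f \<in> Arr E" "Dom E (icmp E A g f) = Dom E f" "Cod E (icmp E A g f) = ar A"
    "d0 A \<cdot> icmp E A g f = d0 A \<cdot> g" "d1 A \<cdot> icmp E A g f = d1 A \<cdot> f"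
proof -
  note [simp] = icat_pair[OF A c] A icat_pb[OF A]
  show "icmp E A g f \<in> Arr E" "Dom E (icmp E A g f) = Dom E f" "Cod E (icmp E A g f) = ar A"
    by (simp_all add: icmp_def)
  have d: "d0 A \<cdot> mul A = d0 A \<cdot> pb1 E (d1 A) (d0 A)" "d1 A \<cdot> mul A = d1 A \<cdot> pb2 E (d1 A) (d0 A)"
    using A unfolding internal_category_def Let_def by blast+
  show "d0 A \<cdot> icmp E A g f = d0 A \<cdot> g" "d1 A \<cdot> icmp E A g f = d1 A \<cdot> f"
    unfolding icmp_def by (simp_all add: cmp_reassoc[OF d(1)] cmp_reassoc[OF d(2)] del: icat_pb(7))
qed

text \<open>Pairing into the pullback commutes with precomposition. This naturality in the stage of
  definition is what carries a law from the universal element to all others.\<close>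

lemma icmp_cmp [simp]:
  assumes A: "internal_category E A"
    and c: "g \<in> Arr E" "f \<in> Arr E" "Cod E g = ar A" "Cod E f = ar A" "Dom E g = Dom E f"
      "d1 A \<cdot> g = d0 A \<cdot> f"
    and x: "x \<in> Arr E" "Cod E x = Dom E f"
  shows "icmp E A g f \<cdot> x = icmp E A (g \<cdot> x) (f \<cdot> x)"
proof -
  note [simp] = icat_pair[OF A c] A icat_pb[OF A]
  have "pb_pair E (d1 A) (d0 A) (g \<cdot> x) (f \<cdot> x) = pb_pair E (d1 A) (d0 A) g f \<cdot> x"
    using x c
    by - (rule pb_pair_eqI, simp_all add: cmp_reassoc[OF icat_pair(4)[OF A c]] cmp_reassoc[OF icat_pair(5)[OF A c]])
  then show ?thesis using x by (simp add: icmp_def)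
qed

text \<open>The pair of projections is the universal composable pair, and it is classified by the
  identity. Laws stated with \<open>mul\<close> can thereby be read as laws about
  \<open>icmp\<close>.\<close>

lemma mul_eq_icmp:
  assumes A: "internal_category E A"
  shows "mul A = icmp E A (pb1 E (d1 A) (d0 A)) (pb2 E (d1 A) (d0 A))"
proof -
  note [simp] = A icat_pb[OF A]
  have "pb_pair E (d1 A) (d0 A) (pb1 E (d1 A) (d0 A)) (pb2 E (d1 A) (d0 A)) = Idn E (pb_obj E (d1 A) (d0 A))"
    by (rule pb_pair_eqI) simp_all
  then show ?thesis by (simp add: icmp_def)
qed

lemma icmp_idm [simp]:
  assumes A: "internal_category E A" and f: "f \<in> Arr E" "Cod E f = ar A"
  shows "icmp E A (idm A \<cdot> (d0 A \<cdot> f)) f = f" "icmp E A f (idm A \<cdot> (d1 A \<cdot> f)) = f"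
proof -
  have *: "icmp E A (idm A \<cdot> d0 A) (Idn E (ar A)) = Idn E (ar A)"
    "icmp E A (Idn E (ar A)) (idm A \<cdot> d1 A) = Idn E (ar A)"
    using A unfolding internal_category_def Let_def by blast+
  show "icmp E A (idm A \<cdot> (d0 A \<cdot> f)) f = f" "icmp E A f (idm A \<cdot> (d1 A \<cdot> f)) = f"
    using arg_cong[OF *(1), of "\<lambda>u. u \<cdot> f"] arg_cong[OF *(2), of "\<lambda>u. u \<cdot> f"] f A by simp_all
qed

text \<open>The simplifier may rewrite \<open>d0 A \<cdot> f\<close> before the unit law can match
  it; here the end is a variable tied to \<open>f\<close> by a premise.\<close>

lemma icmp_idm_eq [simp]:
  assumes A: "internal_category E A" and f: "f \<in> Arr E" "Cod E f = ar A"
  shows "d0 A \<cdot> f = x \<Longrightarrow> icmp E A (idm A \<cdot> x) f = f"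
    "d1 A \<cdot> f = x \<Longrightarrow> icmp E A f (idm A \<cdot> x) = f"
  using icmp_idm[OF assms] by auto

text \<open>The axiom is associativity of the universal composable triple; precomposing it with the
  arrow classifying \<open>(h, g, f)\<close> gives the general case.\<close>

lemma icmp_assoc [simp]:
  assumes A: "internal_category E A"
    and c: "h \<in> Arr E" "g \<in> Arr E" "f \<in> Arr E" "Cod E h = ar A" "Cod E g = ar A" "Cod E f = ar A"
      "Dom E h = Dom E f" "Dom E g = Dom E f" "d1 A \<cdot> h = d0 A \<cdot> g" "d1 A \<cdot> g = d0 A \<cdot> f"
  shows "icmp E A (icmp E A h g) f = icmp E A h (icmp E A g f)"
proof -
  let ?p1 = "pb1 E (d1 A) (d0 A)" let ?p2 = "pb2 E (d1 A) (d0 A)"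
  let ?r = "pb1 E (d1 A \<cdot> ?p2) (d0 A)" let ?t = "pb2 E (d1 A \<cdot> ?p2) (d0 A)"
  let ?hg = "pb_pair E (d1 A) (d0 A) h g"
  \<comment> \<open>The classifying arrow of the triple: \<open>?r\<close> returns the pair
    \<open>(h, g)\<close> and \<open>?t\<close> returns \<open>f\<close>.\<close>
  let ?u = "pb_pair E (d1 A \<cdot> ?p2) (d0 A) ?hg f"
  note [simp] = A icat_pb[OF A]
  have gh: "Dom E h = Dom E g" using c by simp
  note hg = icat_pair[OF A c(1,2,4,5) gh c(9)]
  have p2: "d1 A \<cdot> ?p2 \<in> Arr E" "d0 A \<in> Arr E" "Cod E (d1 A \<cdot> ?p2) = Cod E (d0 A)" by simp_all
  note r = pb_arr[OF p2, simplified]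
  have "(d1 A \<cdot> ?p2) \<cdot> ?hg = d0 A \<cdot> f" using hg c by simp
  then have u: "?u \<in> Arr E" "Dom E ?u = Dom E f" "Cod E ?u = pb_obj E (d1 A \<cdot> ?p2) (d0 A)"
    "?r \<cdot> ?u = ?hg" "?t \<cdot> ?u = f"
    using pb_pair_arr[OF p2, of ?hg f] c hg by simp_all
  have *: "icmp E A (mul A \<cdot> ?r) ?t = icmp E A (?p1 \<cdot> ?r) (icmp E A (?p2 \<cdot> ?r) ?t)"
    using A unfolding internal_category_def Let_def by blast
  have d1p1: "x \<in> Arr E \<Longrightarrow> Cod E x = pb_obj E (d1 A) (d0 A) \<Longrightarrow> d1 A \<cdot> (?p1 \<cdot> x) = d0 A \<cdot> (?p2 \<cdot> x)" for x
    by (simp add: cmp_reassoc[OF icat_pb(7)[OF A]])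
  have mr: "mul A \<cdot> ?r = icmp E A (?p1 \<cdot> ?r) (?p2 \<cdot> ?r)"
    using r by (subst mul_eq_icmp[OF A]) simp
  have pu: "?p1 \<cdot> (?r \<cdot> ?u) = h" "?p2 \<cdot> (?r \<cdot> ?u) = g" using u hg by simp_all
  have "icmp E A (icmp E A (?p1 \<cdot> ?r) (?p2 \<cdot> ?r)) ?t \<cdot> ?u = icmp E A (icmp E A h g) f"
    using u(1-3,5) pu r c by (simp add: d1p1)
  moreover have "icmp E A (?p1 \<cdot> ?r) (icmp E A (?p2 \<cdot> ?r) ?t) \<cdot> ?u = icmp E A h (icmp E A g f)"
    using u(1-3,5) pu r c by (simp add: d1p1)
  ultimately show ?thesis using * mr by simp
qed

section \<open>Functors and natural transformations on generalised elements\<close>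

lemma ifun_icat [simp]:
  assumes "internal_functor E f"
  shows "internal_category E (fdom f)" "internal_category E (fcod f)"
  using assms by (auto simp: internal_functor_def Let_def)

text \<open>The variables \<open>A\<close> and \<open>B\<close>, fixed by premises, let the
  equations fire even when the simplifier knows the domain or codomain under another name.\<close>

lemma ifun_arr [simp]:
  assumes "internal_functor E f"
  shows "fob f \<in> Arr E" "Dom E (fob f) = ob (fdom f)" "Cod E (fob f) = ob (fcod f)"
    "far f \<in> Arr E" "Dom E (far f) = ar (fdom f)" "Cod E (far f) = ar (fcod f)"
    "fcod f = B \<Longrightarrow> d0 B \<cdot> far f = fob f \<cdot> d0 (fdom f)"
    "fcod f = B \<Longrightarrow> d1 B \<cdot> far f = fob f \<cdot> d1 (fdom f)"
    "fdom f = A \<Longrightarrow> far f \<cdot> idm A = idm (fcod f) \<cdot> fob f"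
  using assms unfolding internal_functor_def hom_def Let_def by auto

lemma ifun_arr_cmp [simp]:
  assumes "internal_functor E f" "x \<in> Arr E"
  shows "fcod f = B \<Longrightarrow> Cod E x = ar (fdom f) \<Longrightarrow> d0 B \<cdot> (far f \<cdot> x) = fob f \<cdot> (d0 (fdom f) \<cdot> x)"
    "fcod f = B \<Longrightarrow> Cod E x = ar (fdom f) \<Longrightarrow> d1 B \<cdot> (far f \<cdot> x) = fob f \<cdot> (d1 (fdom f) \<cdot> x)"
    "fdom f = A \<Longrightarrow> Cod E x = ob (fdom f) \<Longrightarrow> far f \<cdot> (idm A \<cdot> x) = idm (fcod f) \<cdot> (fob f \<cdot> x)"
  using assms by (auto simp: cmp_reassoc[OF ifun_arr(7)] cmp_reassoc[OF ifun_arr(8)] cmp_reassoc[OF ifun_arr(9)])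

lemma far_icmp [simp]:
  assumes f: "internal_functor E f" and A: "fdom f = A"
    and c: "h \<in> Arr E" "g \<in> Arr E" "Cod E h = ar A" "Cod E g = ar A"
      "Dom E h = Dom E g" "d1 A \<cdot> h = d0 A \<cdot> g"
  shows "far f \<cdot> icmp E A h g = icmp E (fcod f) (far f \<cdot> h) (far f \<cdot> g)"
proof -
  have IA: "internal_category E A" using f A by auto
  note [simp] = A f IA icat_pb[OF IA]
  note p = icat_pair[OF IA c]
  have *: "far f \<cdot> mul A = icmp E (fcod f) (far f \<cdot> pb1 E (d1 A) (d0 A)) (far f \<cdot> pb2 E (d1 A) (d0 A))"
    using f unfolding internal_functor_def Let_def A by blast
  have "far f \<cdot> icmp E A h g = (far f \<cdot> mul A) \<cdot> pb_pair E (d1 A) (d0 A) h g"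
    using p by (simp add: icmp_def)
  also have "\<dots> = icmp E (fcod f) (far f \<cdot> h) (far f \<cdot> g)"
    unfolding * using p c by simp
  finally show ?thesis .
qed

text \<open>Converse of \<open>far_icmp\<close>: preservation of all generalised composites, taken
  at the two projections, is the axiom about \<open>mul\<close>.\<close>

lemma internal_functorI:
  assumes A: "internal_category E (fdom f)" and B: "internal_category E (fcod f)"
    and "fob f \<in> hom E (ob (fdom f)) (ob (fcod f))" "far f \<in> hom E (ar (fdom f)) (ar (fcod f))"
    and "d0 (fcod f) \<cdot> far f = fob f \<cdot> d0 (fdom f)"
    and "d1 (fcod f) \<cdot> far f = fob f \<cdot> d1 (fdom f)"
    and "far f \<cdot> idm (fdom f) = idm (fcod f) \<cdot> fob f"
    and icmp: "\<And>h g. \<lbrakk>h \<in> Arr E; g \<in> Arr E; Cod E h = ar (fdom f); Cod E g = ar (fdom f);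
      Dom E h = Dom E g; d1 (fdom f) \<cdot> h = d0 (fdom f) \<cdot> g\<rbrakk>
      \<Longrightarrow> far f \<cdot> icmp E (fdom f) h g = icmp E (fcod f) (far f \<cdot> h) (far f \<cdot> g)"
  shows "internal_functor E f"
  unfolding internal_functor_def Let_def using assms(1-7) mul_eq_icmp[OF A]
  by (simp add: icat_pb[OF A] icmp)

lemma inat_functor [simp]:
  assumes "internal_nat E \<alpha>"
  shows "internal_functor E (ndom \<alpha>)" "internal_functor E (ncod \<alpha>)"
    "fdom (ncod \<alpha>) = fdom (ndom \<alpha>)" "fcod (ncod \<alpha>) = fcod (ndom \<alpha>)"
  using assms unfolding internal_nat_def Let_def by blast+

lemma inat_arr [simp]:
  assumes "internal_nat E \<alpha>"
  shows "ncom \<alpha> \<in> Arr E" "Dom E (ncom \<alpha>) = ob (fdom (ndom \<alpha>))"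
    "Cod E (ncom \<alpha>) = ar (fcod (ndom \<alpha>))"
    "fcod (ndom \<alpha>) = B \<Longrightarrow> d1 B \<cdot> ncom \<alpha> = fob (ndom \<alpha>)"
    "fcod (ndom \<alpha>) = B \<Longrightarrow> d0 B \<cdot> ncom \<alpha> = fob (ncod \<alpha>)"
  using assms unfolding internal_nat_def hom_def Let_def by auto

lemma inat_arr_cmp [simp]:
  assumes "internal_nat E \<alpha>" "x \<in> Arr E" "Cod E x = ob (fdom (ndom \<alpha>))" "fcod (ndom \<alpha>) = B"
  shows "d1 B \<cdot> (ncom \<alpha> \<cdot> x) = fob (ndom \<alpha>) \<cdot> x" "d0 B \<cdot> (ncom \<alpha> \<cdot> x) = fob (ncod \<alpha>) \<cdot> x"
  using assms by (auto simp: cmp_reassoc[OF inat_arr(4)] cmp_reassoc[OF inat_arr(5)])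

text \<open>Naturality at a generalised arrow \<open>x\<close>, obtained by precomposing the axiom
  with \<open>x\<close>. Taking \<open>x\<close> to be the arrow part of a functor or the component
  of another transformation gives horizontal composition and interchange.\<close>

lemma inat_natural:
  assumes "internal_nat E \<alpha>" "ndom \<alpha> = f" "ncod \<alpha> = g" "fdom f = A" "fcod f = B"
    and "x \<in> Arr E" "Cod E x = ar A"
  shows "icmp E B (ncom \<alpha> \<cdot> (d0 A \<cdot> x)) (far f \<cdot> x) = icmp E B (far g \<cdot> x) (ncom \<alpha> \<cdot> (d1 A \<cdot> x))"
proof -
  have "icmp E B (ncom \<alpha> \<cdot> d0 A) (far f) \<cdot> x = icmp E B (far g) (ncom \<alpha> \<cdot> d1 A) \<cdot> x"
    using assms(1) unfolding internal_nat_def Let_def assms(2-5) by simp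
  then show ?thesis using assms by auto
qed

section \<open>The 2-category of internal categories\<close>

lemma internal_natI:
  assumes f: "internal_functor E f" and g: "internal_functor E g" and "fdom f = A" "fcod f = B" "fdom g = A" "fcod g = B"
    and "c \<in> Arr E" "Dom E c = ob A" "Cod E c = ar B" "d1 B \<cdot> c = fob f" "d0 B \<cdot> c = fob g"
    and "icmp E B (c \<cdot> d0 A) (far f) = icmp E B (far g) (c \<cdot> d1 A)"
  shows "internal_nat E \<lparr> ndom = f, ncod = g, ncom = c \<rparr>"
  unfolding internal_nat_def Let_def hom_def using assms by simp

lemma inat_natural_arr:
  assumes "internal_nat E \<alpha>"
  shows "icmp E (fcod (ndom \<alpha>)) (ncom \<alpha> \<cdot> d0 (fdom (ndom \<alpha>))) (far (ndom \<alpha>)) =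
    icmp E (fcod (ndom \<alpha>)) (far (ncod \<alpha>)) (ncom \<alpha> \<cdot> d1 (fdom (ndom \<alpha>)))"
  using inat_natural[OF assms refl refl refl refl, of "Idn E (ar (fdom (ndom \<alpha>)))"] assms by simp

lemma internal_functor_id:
  assumes "internal_category E A"
  shows "internal_functor E (ifun_id E A)"
  using assms by (intro internal_functorI) (simp_all add: ifun_id_def hom_def)

lemma internal_functor_cmp:
  assumes "internal_functor E f" "internal_functor E g" "fcod f = fdom g"
  shows "internal_functor E (ifun_cmp E g f)"
  using assms by (intro internal_functorI) (simp_all add: ifun_cmp_def hom_def)

lemma internal_nat_id:
  assumes "internal_functor E f"
  shows "internal_nat E (inat_id E f)"
  unfolding inat_id_def using assms by (intro internal_natI[OF _ _ refl refl]) simp_all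

text \<open>The two naturality squares are pasted along \<open>far (ndom \<beta>)\<close>, with
  associativity moving the brackets between the two uses.\<close>

lemma internal_nat_vcmp:
  assumes a: "internal_nat E \<alpha>" and b: "internal_nat E \<beta>" and eq: "ncod \<alpha> = ndom \<beta>"
  shows "internal_nat E (inat_vcmp E \<beta> \<alpha>)"
proof -
  let ?f = "ndom \<alpha>" and ?g = "ndom \<beta>" and ?h = "ncod \<beta>"
  let ?A = "fdom ?f" and ?B = "fcod ?f"
  have g: "fdom ?g = ?A" "fcod ?g = ?B" using inat_functor(3,4)[OF a] eq by simp_all
  note [simp] = a b eq g
  have "icmp E ?B (icmp E ?B (ncom \<beta>) (ncom \<alpha>) \<cdot> d0 ?A) (far ?f)
      = icmp E ?B (ncom \<beta> \<cdot> d0 ?A) (icmp E ?B (ncom \<alpha> \<cdot> d0 ?A) (far ?f))"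
    by simp
  also have "\<dots> = icmp E ?B (ncom \<beta> \<cdot> d0 ?A) (icmp E ?B (far ?g) (ncom \<alpha> \<cdot> d1 ?A))"
    using inat_natural_arr[OF a] by simp
  also have "\<dots> = icmp E ?B (icmp E ?B (ncom \<beta> \<cdot> d0 ?A) (far ?g)) (ncom \<alpha> \<cdot> d1 ?A)"
    by simp
  also have "\<dots> = icmp E ?B (icmp E ?B (far ?h) (ncom \<beta> \<cdot> d1 ?A)) (ncom \<alpha> \<cdot> d1 ?A)"
    using inat_natural_arr[OF b] by simp
  also have "\<dots> = icmp E ?B (far ?h) (icmp E ?B (ncom \<beta>) (ncom \<alpha>) \<cdot> d1 ?A)"
    by simp
  finally show ?thesis unfolding inat_vcmp_def by (intro internal_natI[OF _ _ refl refl]) simp_all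
qed

text \<open>The square of the composite is the image under \<open>ndom \<beta>\<close> of the square
  of \<open>\<alpha>\<close>, pasted with the square of \<open>\<beta>\<close> at the arrows
  \<open>far (ncod \<alpha>)\<close>.\<close>

lemma internal_nat_hcmp:
  assumes a: "internal_nat E \<alpha>" and b: "internal_nat E \<beta>" and eq: "fcod (ndom \<alpha>) = fdom (ndom \<beta>)"
  shows "internal_nat E (inat_hcmp E \<beta> \<alpha>)"
proof -
  let ?f = "ndom \<alpha>" and ?f' = "ncod \<alpha>" and ?g = "ndom \<beta>" and ?g' = "ncod \<beta>"
  let ?A = "fdom ?f" and ?B = "fdom ?g" and ?C = "fcod ?g"
  let ?a = "ncom \<alpha>" and ?b = "ncom \<beta>"
  note [simp] = a b eq
  have "far ?g \<cdot> icmp E ?B (?a \<cdot> d0 ?A) (far ?f) = far ?g \<cdot> icmp E ?B (far ?f') (?a \<cdot> d1 ?A)"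
    using inat_natural_arr[OF a] by simp
  then have 1: "icmp E ?C (far ?g \<cdot> (?a \<cdot> d0 ?A)) (far ?g \<cdot> far ?f)
      = icmp E ?C (far ?g \<cdot> far ?f') (far ?g \<cdot> (?a \<cdot> d1 ?A))"
    by simp
  have 2: "icmp E ?C (?b \<cdot> (fob ?f' \<cdot> d0 ?A)) (far ?g \<cdot> far ?f')
      = icmp E ?C (far ?g' \<cdot> far ?f') (?b \<cdot> (fob ?f' \<cdot> d1 ?A))"
    using inat_natural[OF b refl refl refl refl, of "far ?f'"] by simp
  have "icmp E ?C (icmp E ?C (?b \<cdot> fob ?f') (far ?g \<cdot> ?a) \<cdot> d0 ?A) (far ?g \<cdot> far ?f)
      = icmp E ?C (?b \<cdot> (fob ?f' \<cdot> d0 ?A)) (icmp E ?C (far ?g \<cdot> (?a \<cdot> d0 ?A)) (far ?g \<cdot> far ?f))"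
    by simp
  also have "\<dots> = icmp E ?C (icmp E ?C (?b \<cdot> (fob ?f' \<cdot> d0 ?A)) (far ?g \<cdot> far ?f')) (far ?g \<cdot> (?a \<cdot> d1 ?A))"
    unfolding 1 by simp
  also have "\<dots> = icmp E ?C (far ?g' \<cdot> far ?f') (icmp E ?C (?b \<cdot> fob ?f') (far ?g \<cdot> ?a) \<cdot> d1 ?A)"
    unfolding 2 by simp
  finally show ?thesis unfolding inat_hcmp_def
    by (intro internal_natI[OF _ _ refl refl] internal_functor_cmp) (simp_all add: ifun_cmp_def)
qed

lemma category_One_Cat: "category (One (Cat E))"
  by unfold_locales
    (auto simp: Cat_def hom_def internal_functor_id internal_functor_cmp,
      auto simp: ifun_id_def ifun_cmp_def)

lemma category_Vert_Cat: "category (Vert (Cat E))"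
  by unfold_locales
    (auto simp: Cat_def hom_def internal_nat_id internal_nat_vcmp,
      auto simp: inat_id_def inat_vcmp_def)

lemma category_horiz_Cat: "category (horiz (Cat E))"
proof -
  \<comment> \<open>On components, the functor \<open>ndom \<gamma>\<close> distributes over the
    inner composite; associativity of \<open>icmp\<close> does the rest.\<close>
  have *: "inat_hcmp E \<gamma> (inat_hcmp E \<beta> \<alpha>) = inat_hcmp E (inat_hcmp E \<gamma> \<beta>) \<alpha>"
    if "internal_nat E \<alpha>" "internal_nat E \<beta>" "internal_nat E \<gamma>"
      "fcod (ndom \<alpha>) = fdom (ndom \<beta>)" "fcod (ndom \<beta>) = fdom (ndom \<gamma>)" for \<alpha> \<beta> \<gamma>
    using that by (simp add: inat_hcmp_def ifun_cmp_def)
  show ?thesis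
    by unfold_locales
      (auto simp: Cat_def horiz_def hom_def internal_functor_id internal_nat_id internal_nat_hcmp *,
        auto simp: inat_id_def inat_hcmp_def ifun_cmp_def ifun_id_def)
qed

text \<open>After expansion both sides are fourfold composites that differ only in the middle two
  factors. Exchanging these is naturality of \<open>\<beta>\<close> at the component of
  \<open>\<alpha>'\<close>.\<close>

lemma inat_interchange:
  assumes a: "internal_nat E \<alpha>" and a': "internal_nat E \<alpha>'" and b: "internal_nat E \<beta>" and b': "internal_nat E \<beta>'"
    and eq: "ncod \<alpha> = ndom \<alpha>'" "ncod \<beta> = ndom \<beta>'" "fcod (ndom \<alpha>) = fdom (ndom \<beta>)"
  shows "inat_hcmp E (inat_vcmp E \<beta>' \<beta>) (inat_vcmp E \<alpha>' \<alpha>) = inat_vcmp E (inat_hcmp E \<beta>' \<alpha>') (inat_hcmp E \<beta> \<alpha>)"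
proof -
  have m: "fdom (ndom \<alpha>') = fdom (ndom \<alpha>)" "fcod (ndom \<alpha>') = fdom (ndom \<beta>)"
    "fdom (ndom \<beta>') = fdom (ndom \<beta>)" "fcod (ndom \<beta>') = fcod (ndom \<beta>)"
    using inat_functor(3,4)[OF a] inat_functor(3,4)[OF b] eq by simp_all
  note [simp] = a a' b b' eq m
  let ?C = "fcod (ndom \<beta>)" and ?f' = "fob (ndom \<alpha>')" and ?f'' = "fob (ncod \<alpha>')"
  let ?g = "far (ndom \<beta>)" and ?g' = "far (ndom \<beta>')"
  have 1: "icmp E ?C (ncom \<beta> \<cdot> ?f'') (?g \<cdot> ncom \<alpha>') = icmp E ?C (?g' \<cdot> ncom \<alpha>') (ncom \<beta> \<cdot> ?f')"
    using inat_natural[OF b refl refl refl refl, of "ncom \<alpha>'"] by simp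
  have "icmp E ?C (icmp E ?C (ncom \<beta>') (ncom \<beta>) \<cdot> ?f'') (?g \<cdot> icmp E (fdom (ndom \<beta>)) (ncom \<alpha>') (ncom \<alpha>))
      = icmp E ?C (ncom \<beta>' \<cdot> ?f'') (icmp E ?C (icmp E ?C (ncom \<beta> \<cdot> ?f'') (?g \<cdot> ncom \<alpha>')) (?g \<cdot> ncom \<alpha>))"
    by simp
  also have "\<dots> = icmp E ?C (icmp E ?C (ncom \<beta>' \<cdot> ?f'') (?g' \<cdot> ncom \<alpha>')) (icmp E ?C (ncom \<beta> \<cdot> ?f') (?g \<cdot> ncom \<alpha>))"
    unfolding 1 by simp
  finally show ?thesis by (simp add: inat_hcmp_def inat_vcmp_def ifun_cmp_def)
qed

lemma two_category_Cat: "two_category (Cat E)"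
proof (rule two_category.intro)
  show "category (One (Cat E))" "category (Vert (Cat E))" "category (horiz (Cat E))"
    by (rule category_One_Cat category_Vert_Cat category_horiz_Cat)+
  show "Obj (Vert (Cat E)) = Arr (One (Cat E))" by (simp add: Cat_def)
next
  fix \<alpha> assume "\<alpha> \<in> Arr (Vert (Cat E))"
  then show "Dom (One (Cat E)) (Cod (Vert (Cat E)) \<alpha>) = Dom (One (Cat E)) (Dom (Vert (Cat E)) \<alpha>) \<and>
      Cod (One (Cat E)) (Cod (Vert (Cat E)) \<alpha>) = Cod (One (Cat E)) (Dom (Vert (Cat E)) \<alpha>)"
    by (simp add: Cat_def)
next
  fix \<alpha> f f' \<beta> g g'
  assume "\<alpha> \<in> hom (Vert (Cat E)) f f'" "\<beta> \<in> hom (Vert (Cat E)) g g'" "Cod (One (Cat E)) f = Dom (One (Cat E)) g"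
  then show "HCmp (Cat E) \<beta> \<alpha> \<in> hom (Vert (Cat E)) (g \<cdot>\<^bsub>One (Cat E)\<^esub> f) (g' \<cdot>\<^bsub>One (Cat E)\<^esub> f')"
    by (auto simp: Cat_def hom_def internal_nat_hcmp) (simp_all add: inat_hcmp_def)
next
  fix f g
  assume "f \<in> Arr (One (Cat E))" "g \<in> Arr (One (Cat E))" "Cod (One (Cat E)) f = Dom (One (Cat E)) g"
  then show "Idn (Vert (Cat E)) g \<star>\<^bsub>Cat E\<^esub> Idn (Vert (Cat E)) f = Idn (Vert (Cat E)) (g \<cdot>\<^bsub>One (Cat E)\<^esub> f)"
    by (simp add: Cat_def inat_hcmp_def inat_id_def ifun_cmp_def)
next
  fix \<alpha> f f' \<alpha>' f'' \<beta> g g' \<beta>' g''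
  assume "\<alpha> \<in> hom (Vert (Cat E)) f f'" "\<alpha>' \<in> hom (Vert (Cat E)) f' f''"
    "\<beta> \<in> hom (Vert (Cat E)) g g'" "\<beta>' \<in> hom (Vert (Cat E)) g' g''"
    "Cod (One (Cat E)) f = Dom (One (Cat E)) g"
  then show "(\<beta>' \<cdot>\<^bsub>Vert (Cat E)\<^esub> \<beta>) \<star>\<^bsub>Cat E\<^esub> (\<alpha>' \<cdot>\<^bsub>Vert (Cat E)\<^esub> \<alpha>)
      = (\<beta>' \<star>\<^bsub>Cat E\<^esub> \<alpha>') \<cdot>\<^bsub>Vert (Cat E)\<^esub> (\<beta> \<star>\<^bsub>Cat E\<^esub> \<alpha>)"
    using inat_interchange[of \<alpha> \<alpha>' \<beta> \<beta>'] by (auto simp: Cat_def hom_def)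
qed

section \<open>Fully faithful functors\<close>

text \<open>An arrow into a binary product is a pair of arrows, so a cone over the square is a
  triple \<open>x\<close>, \<open>y\<close>, \<open>h\<close>. The statement is about bare arrows
  because it is also applied to the raw pullback from which a full image is built, before that
  carries any category structure.\<close>

lemma is_pullback_pair_iff:
  assumes [simp]: "a \<in> Arr E" "b \<in> Arr E" "Dom E b = Dom E a" "Cod E b = Cod E a"
    "c \<in> Arr E" "Cod E c = Cod E a" "p \<in> Arr E" "Cod E p = Dom E a"
    "s \<in> Arr E" "t \<in> Arr E" "Dom E s = Dom E p" "Dom E t = Dom E p" "Cod E s = Dom E c" "Cod E t = Dom E c"
    and eq: "a \<cdot> p = c \<cdot> s" "b \<cdot> p = c \<cdot> t"
  shows "is_pullback E (pr_pair E a b) (pr_map E c c) p (pr_pair E s t) \<longleftrightarrow>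
    (\<forall>x\<in>Arr E. \<forall>y\<in>Arr E. \<forall>h\<in>Arr E. Dom E x = Dom E h \<longrightarrow> Dom E y = Dom E h \<longrightarrow>
      Cod E x = Dom E c \<longrightarrow> Cod E y = Dom E c \<longrightarrow> Cod E h = Dom E a \<longrightarrow>
      a \<cdot> h = c \<cdot> x \<longrightarrow> b \<cdot> h = c \<cdot> y \<longrightarrow>
      (\<exists>!u. u \<in> hom E (Dom E h) (Dom E p) \<and> p \<cdot> u = h \<and> s \<cdot> u = x \<and> t \<cdot> u = y))"
    (is "?pb \<longleftrightarrow> ?gen")
proof -
  let ?f = "pr_pair E a b" and ?g = "pr_map E c c" and ?q = "pr_pair E s t"
  have cone: "?f \<cdot> h = ?g \<cdot> pr_pair E x y \<longleftrightarrow> a \<cdot> h = c \<cdot> x \<and> b \<cdot> h = c \<cdot> y"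
    if "x \<in> Arr E" "y \<in> Arr E" "h \<in> Arr E" "Dom E x = Dom E h" "Dom E y = Dom E h"
      "Cod E x = Dom E c" "Cod E y = Dom E c" "Cod E h = Dom E a" for x y h
    using that by (simp add: pr_map_cmp_pair pr_pair_cmp pr_pair_eq_iff)
  have lift: "?q \<cdot> u = pr_pair E x y \<longleftrightarrow> s \<cdot> u = x \<and> t \<cdot> u = y"
    if "x \<in> Arr E" "y \<in> Arr E" "u \<in> hom E (Dom E x) (Dom E p)" "Dom E y = Dom E x"
      "Cod E x = Dom E c" "Cod E y = Dom E c" for x y u
    using that by (simp add: pr_pair_cmp pr_pair_eq_iff hom_def)
  have "?pb \<longleftrightarrow> (\<forall>T\<in>Obj E. \<forall>h \<in> hom E T (Dom E a). \<forall>k \<in> hom E T (pr_obj E (Dom E c) (Dom E c)).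
        ?f \<cdot> h = ?g \<cdot> k \<longrightarrow> (\<exists>!u. u \<in> hom E T (Dom E p) \<and> p \<cdot> u = h \<and> ?q \<cdot> u = k))"
    using eq by (simp add: is_pullback_def pr_pair_cmp pr_map_cmp_pair)
  also have "\<dots> \<longleftrightarrow> ?gen"
  proof
    assume pb: "\<forall>T\<in>Obj E. \<forall>h \<in> hom E T (Dom E a). \<forall>k \<in> hom E T (pr_obj E (Dom E c) (Dom E c)).
        ?f \<cdot> h = ?g \<cdot> k \<longrightarrow> (\<exists>!u. u \<in> hom E T (Dom E p) \<and> p \<cdot> u = h \<and> ?q \<cdot> u = k)"
    show ?gen
    proof (intro ballI impI)
      fix x y h
      assume xyh: "x \<in> Arr E" "y \<in> Arr E" "h \<in> Arr E" "Dom E x = Dom E h" "Dom E y = Dom E h"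
        "Cod E x = Dom E c" "Cod E y = Dom E c" "Cod E h = Dom E a" "a \<cdot> h = c \<cdot> x" "b \<cdot> h = c \<cdot> y"
      have "\<exists>!u. u \<in> hom E (Dom E h) (Dom E p) \<and> p \<cdot> u = h \<and> ?q \<cdot> u = pr_pair E x y"
        using pb[rule_format, of "Dom E h" h "pr_pair E x y"] cone[of x y h] xyh
        by (simp add: hom_def)
      then show "\<exists>!u. u \<in> hom E (Dom E h) (Dom E p) \<and> p \<cdot> u = h \<and> s \<cdot> u = x \<and> t \<cdot> u = y"
        \<comment> \<open>\<open>lift\<close> requires \<open>u\<close> to be typed;
          \<open>conj_cong\<close> provides this from the first conjunct under the
          quantifier.\<close>
        using lift[of x y] xyh by (simp cong: conj_cong)
    qed
  next
    assume gen: ?gen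
    show "\<forall>T\<in>Obj E. \<forall>h \<in> hom E T (Dom E a). \<forall>k \<in> hom E T (pr_obj E (Dom E c) (Dom E c)).
        ?f \<cdot> h = ?g \<cdot> k \<longrightarrow> (\<exists>!u. u \<in> hom E T (Dom E p) \<and> p \<cdot> u = h \<and> ?q \<cdot> u = k)"
    proof (intro ballI impI)
      fix T h k
      assume *: "T \<in> Obj E" "h \<in> hom E T (Dom E a)" "k \<in> hom E T (pr_obj E (Dom E c) (Dom E c))"
        and fg: "?f \<cdot> h = ?g \<cdot> k"
      define x where "x = pr1 E (Dom E c) (Dom E c) \<cdot> k"
      define y where "y = pr2 E (Dom E c) (Dom E c) \<cdot> k"
      have xy: "x \<in> Arr E" "y \<in> Arr E" "Dom E x = T" "Dom E y = T" "Cod E x = Dom E c" "Cod E y = Dom E c"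
        and k: "k = pr_pair E x y"
        using * by (auto simp: x_def y_def hom_def pr_pair_eta)
      have h: "h \<in> Arr E" "Dom E h = T" "Cod E h = Dom E a" using * by (auto simp: hom_def)
      have "a \<cdot> h = c \<cdot> x" "b \<cdot> h = c \<cdot> y" using cone[of x y h] xy h fg k by simp_all
      then have "\<exists>!u. u \<in> hom E T (Dom E p) \<and> p \<cdot> u = h \<and> s \<cdot> u = x \<and> t \<cdot> u = y"
        using gen[rule_format, of x y h] xy h by simp
      then show "\<exists>!u. u \<in> hom E T (Dom E p) \<and> p \<cdot> u = h \<and> ?q \<cdot> u = k"
        using lift[of x y] xy k by (simp cong: conj_cong)
    qed
  qed
  finally show ?thesis .
qed

lemma fully_faithful_iff:
  assumes "internal_functor E f"
  shows "fully_faithful E f \<longleftrightarrow>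
    (\<forall>x\<in>Arr E. \<forall>y\<in>Arr E. \<forall>h\<in>Arr E. Dom E x = Dom E h \<longrightarrow> Dom E y = Dom E h \<longrightarrow>
      Cod E x = ob (fdom f) \<longrightarrow> Cod E y = ob (fdom f) \<longrightarrow> Cod E h = ar (fcod f) \<longrightarrow>
      d0 (fcod f) \<cdot> h = fob f \<cdot> x \<longrightarrow> d1 (fcod f) \<cdot> h = fob f \<cdot> y \<longrightarrow>
      (\<exists>!u. u \<in> hom E (Dom E h) (ar (fdom f)) \<and> far f \<cdot> u = h \<and> d0 (fdom f) \<cdot> u = x \<and> d1 (fdom f) \<cdot> u = y))"
  unfolding fully_faithful_def using assms by (subst is_pullback_pair_iff) simp_all

lemma fully_faithful_lift:
  assumes "internal_functor E f" "fully_faithful E f" "fdom f = A" "fcod f = B"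
    and "x \<in> Arr E" "y \<in> Arr E" "h \<in> Arr E" "Dom E x = Dom E h" "Dom E y = Dom E h"
    and "Cod E x = ob A" "Cod E y = ob A" "Cod E h = ar B"
    and "d0 B \<cdot> h = fob f \<cdot> x" "d1 B \<cdot> h = fob f \<cdot> y"
  obtains u where "u \<in> Arr E" "Dom E u = Dom E h" "Cod E u = ar A" "far f \<cdot> u = h"
    "d0 A \<cdot> u = x" "d1 A \<cdot> u = y"
proof -
  have "\<exists>!u. u \<in> hom E (Dom E h) (ar A) \<and> far f \<cdot> u = h \<and> d0 A \<cdot> u = x \<and> d1 A \<cdot> u = y"
    using assms(2)[unfolded fully_faithful_iff[OF assms(1)], rule_format, of x y h] assms by simp
  then show ?thesis using that by (auto simp: hom_def)
qed

text \<open>The uniqueness half: \<open>far f\<close>, \<open>d0\<close> and \<open>d1\<close> are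
  jointly monic on the arrows of the domain.\<close>

lemma fully_faithful_eqI:
  assumes "internal_functor E f" "fully_faithful E f" "fdom f = A"
    and "u \<in> Arr E" "v \<in> Arr E" "Dom E u = Dom E v" "Cod E u = ar A" "Cod E v = ar A"
    and "far f \<cdot> u = far f \<cdot> v" "d0 A \<cdot> u = d0 A \<cdot> v" "d1 A \<cdot> u = d1 A \<cdot> v"
  shows "u = v"
proof -
  have "internal_category E A" using assms(1,3) by auto
  then have "\<exists>!w. w \<in> hom E (Dom E v) (ar A) \<and> far f \<cdot> w = far f \<cdot> v \<and> d0 A \<cdot> w = d0 A \<cdot> v \<and> d1 A \<cdot> w = d1 A \<cdot> v"
    using assms(2)[unfolded fully_faithful_iff[OF assms(1)], rule_format, of "d0 A \<cdot> v" "d1 A \<cdot> v" "far f \<cdot> v"] assms by simp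
  then show ?thesis using assms(4-) unfolding hom_def by auto
qed

text \<open>The ends of \<open>far u\<close> are computed from \<open>fob u\<close>, so agreement on
  objects and after \<open>f\<close> leaves nothing else to compare.\<close>

lemma fully_faithful_functor_eqI:
  assumes f: "internal_functor E f" "fully_faithful E f"
    and u: "internal_functor E u" "fcod u = fdom f" and v: "internal_functor E v" "fcod v = fdom f"
    and eq: "fdom u = fdom v" "fob u = fob v" "far f \<cdot> far u = far f \<cdot> far v"
  shows "u = v"
proof -
  have "far u = far v"
    using assms ifun_arr(7,8)[OF u(1) u(2)] ifun_arr(7,8)[OF v(1) v(2)]
    by - (rule fully_faithful_eqI[OF f refl], simp_all)
  then show ?thesis using assms by (intro ifun.equality) simp_all
qed

text \<open>Functoriality forces the arrow part to have ends \<open>u0 \<cdot> d0\<close> and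
  \<open>u0 \<cdot> d1\<close>, and it must lie over \<open>far q\<close>, so it is the
  corresponding lift. Both sides of each functor law have equal ends and equal images under
  \<open>f\<close>, because \<open>q\<close> is a functor.\<close>

lemma fully_faithful_functor_lift:
  assumes f: "internal_functor E f" and ff: "fully_faithful E f"
    and q: "internal_functor E q" "fcod q = fcod f"
    and u0: "u0 \<in> Arr E" "Dom E u0 = ob (fdom q)" "Cod E u0 = ob (fdom f)" "fob f \<cdot> u0 = fob q"
  obtains u where "internal_functor E u" "fdom u = fdom q" "fcod u = fdom f" "fob u = u0"
    "ifun_cmp E f u = q"
proof -
  let ?B = "fdom q" and ?X = "fdom f"
  note [simp] = f q u0
  have fu0: "fob f \<cdot> (u0 \<cdot> x) = fob q \<cdot> x" if "x \<in> Arr E" "Cod E x = ob ?B" for x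
    using that by (simp add: cmp_reassoc[OF u0(4)])
  obtain u1 where u1 [simp]: "u1 \<in> Arr E" "Dom E u1 = ar ?B" "Cod E u1 = ar ?X"
    and fu1: "far f \<cdot> u1 = far q" and du1 [simp]: "d0 ?X \<cdot> u1 = u0 \<cdot> d0 ?B" "d1 ?X \<cdot> u1 = u0 \<cdot> d1 ?B"
    by (rule fully_faithful_lift[OF f ff refl refl, of "u0 \<cdot> d0 ?B" "u0 \<cdot> d1 ?B" "far q"])
      (simp_all add: fu0)
  have fu1_cmp: "far f \<cdot> (u1 \<cdot> x) = far q \<cdot> x" if "x \<in> Arr E" "Cod E x = ar ?B" for x
    using that by (simp add: cmp_reassoc[OF fu1])
  have du1_cmp [simp]: "d0 ?X \<cdot> (u1 \<cdot> x) = u0 \<cdot> (d0 ?B \<cdot> x)" "d1 ?X \<cdot> (u1 \<cdot> x) = u0 \<cdot> (d1 ?B \<cdot> x)"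
    if "x \<in> Arr E" "Cod E x = ar ?B" for x
    using that by (simp_all add: cmp_reassoc[OF du1(1)] cmp_reassoc[OF du1(2)])
  define u where "u = \<lparr> fdom = ?B, fcod = ?X, fob = u0, far = u1 \<rparr>"
  have idm: "u1 \<cdot> idm ?B = idm ?X \<cdot> u0"
    by (rule fully_faithful_eqI[OF f ff refl]) (simp_all add: fu1_cmp)
  have icmp: "u1 \<cdot> icmp E ?B h g = icmp E ?X (u1 \<cdot> h) (u1 \<cdot> g)"
    if "h \<in> Arr E" "g \<in> Arr E" "Cod E h = ar ?B" "Cod E g = ar ?B" "Dom E h = Dom E g" "d1 ?B \<cdot> h = d0 ?B \<cdot> g"
    for h g
    using that by - (rule fully_faithful_eqI[OF f ff refl], simp_all add: fu1_cmp)
  have "internal_functor E u"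
    by (rule internal_functorI) (simp_all add: u_def hom_def idm icmp)
  moreover have "ifun_cmp E f u = q" by (simp add: ifun_cmp_def u_def fu1)
  ultimately show ?thesis using that by (simp add: u_def)
qed

section \<open>Diagonal functors and diagonal 2-cells\<close>

lemma orthogonal_Cat:
  assumes s: "internal_functor E s" and f: "internal_functor E f" and ff: "fully_faithful E f"
    and orth: "orthogonal E (fob s) (fob f)"
  shows "orthogonal (One (Cat E)) s f"
proof -
  have "\<exists>!u. (internal_functor E u \<and> fdom u = fcod s \<and> fcod u = fdom f) \<and> ifun_cmp E f u = q \<and> ifun_cmp E u s = p"
    if p: "internal_functor E p" "fdom p = fdom s" "fcod p = fdom f"
      and q: "internal_functor E q" "fdom q = fcod s" "fcod q = fcod f"
      and eq: "ifun_cmp E f p = ifun_cmp E q s" for p q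
  proof -
    have eq0: "fob f \<cdot> fob p = fob q \<cdot> fob s" and eq1: "far f \<cdot> far p = far q \<cdot> far s"
      using eq by (simp_all add: ifun_cmp_def)
    have ex1: "\<exists>!u. u \<in> hom E (ob (fcod s)) (ob (fdom f)) \<and> fob f \<cdot> u = fob q \<and> u \<cdot> fob s = fob p"
      using orth[unfolded orthogonal_def, rule_format, of "fob p" "fob q"] s f p q eq0 by (simp add: hom_def)
    then obtain u0 where u0: "u0 \<in> hom E (ob (fcod s)) (ob (fdom f))" "fob f \<cdot> u0 = fob q" "u0 \<cdot> fob s = fob p"
      by blast
    then obtain u where u: "internal_functor E u" "fdom u = fdom q" "fcod u = fdom f" "fob u = u0" "ifun_cmp E f u = q"
      using fully_faithful_functor_lift[OF f ff q(1,3), of u0] q(2) by (auto simp: hom_def)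
    have fu: "far f \<cdot> far u = far q" using u(5) by (auto simp: ifun_cmp_def)
    have us: "internal_functor E (ifun_cmp E u s)" using u s q by (simp add: internal_functor_cmp)
    have "ifun_cmp E u s = p"
    \<comment> \<open>The lift controls only the triangle with \<open>f\<close>. The triangle with
      \<open>s\<close> holds on objects by the choice of \<open>u0\<close>, and after applying
      \<open>f\<close> because the given square commutes.\<close>
    proof (rule fully_faithful_functor_eqI[OF f ff])
      have "far f \<cdot> (far u \<cdot> far s) = far q \<cdot> far s"
        using u s f q by (simp add: cmp_reassoc[OF fu])
      then show "far f \<cdot> far (ifun_cmp E u s) = far f \<cdot> far p" using eq1 by (simp add: ifun_cmp_def)
    qed (use us u s p q u0 in \<open>auto simp: ifun_cmp_def\<close>)
    moreover have "u' = u" if u': "internal_functor E u'" "fdom u' = fcod s" "fcod u' = fdom f"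
      "ifun_cmp E f u' = q" "ifun_cmp E u' s = p" for u'
    proof (rule fully_faithful_functor_eqI[OF f ff])
      have "fob f \<cdot> fob u' = fob q" "fob u' \<cdot> fob s = fob p"
        using u'(4,5) by (auto simp: ifun_cmp_def)
      moreover have "fob u' \<in> hom E (ob (fcod s)) (ob (fdom f))" using u' by (simp add: hom_def)
      ultimately have "fob u' = u0" using ex1 u0 by blast
      then show "fob u' = fob u" using u(4) by simp
      show "far f \<cdot> far u' = far f \<cdot> far u" using u'(4) fu by (auto simp: ifun_cmp_def)
    qed (use u u' q in auto)
    moreover have "fdom u = fcod s" using u(2) q(2) by simp
    ultimately show ?thesis using u(1,3,5) by blast
  qed
  then show ?thesis by (simp add: orthogonal_def Cat_def hom_def)
qed

lemma whisker_left_Cat: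
  assumes "internal_functor E f" "internal_nat E \<alpha>" "fcod (ndom \<alpha>) = fdom f"
  shows "whisker_left (Cat E) f \<alpha> =
    \<lparr> ndom = ifun_cmp E f (ndom \<alpha>), ncod = ifun_cmp E f (ncod \<alpha>), ncom = far f \<cdot> ncom \<alpha> \<rparr>"
  using assms by (simp add: whisker_left_def Cat_def inat_hcmp_def inat_id_def)

lemma whisker_right_Cat:
  assumes "internal_functor E s" "internal_nat E \<beta>" "fcod s = fdom (ndom \<beta>)"
  shows "whisker_right (Cat E) \<beta> s =
    \<lparr> ndom = ifun_cmp E (ndom \<beta>) s, ncod = ifun_cmp E (ncod \<beta>) s, ncom = ncom \<beta> \<cdot> fob s \<rparr>"
  using assms by (simp add: whisker_right_def Cat_def inat_hcmp_def inat_id_def)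

text \<open>The component of \<open>\<gamma>\<close> must run from \<open>fob u\<close> to
  \<open>fob u'\<close> and lie over that of \<open>\<beta>\<close>, so it exists and is unique by
  full faithfulness. Naturality and the whiskering with \<open>s\<close> are then checked after
  \<open>far f\<close>, where they reduce to the naturality of \<open>\<beta>\<close> and to the
  compatibility of \<open>\<alpha>\<close> with \<open>\<beta>\<close>.\<close>

lemma fully_faithful_nat_ex1:
  assumes f: "internal_functor E f" and ff: "fully_faithful E f"
    and s: "internal_functor E s"
    and a: "internal_nat E \<alpha>" "fdom (ndom \<alpha>) = fdom s" "fcod (ndom \<alpha>) = fdom f"
    and b: "internal_nat E \<beta>" "fdom (ndom \<beta>) = fcod s" "fcod (ndom \<beta>) = fcod f"
    and ab: "whisker_left (Cat E) f \<alpha> = whisker_right (Cat E) \<beta> s"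
    and u: "internal_functor E u" "fdom u = fcod s" "fcod u = fdom f"
    and u': "internal_functor E u'" "fdom u' = fcod s" "fcod u' = fdom f"
    and fu: "ifun_cmp E f u = ndom \<beta>" "ifun_cmp E f u' = ncod \<beta>"
    and us: "ifun_cmp E u s = ndom \<alpha>" "ifun_cmp E u' s = ncod \<alpha>"
  shows "\<exists>!\<gamma>. (internal_nat E \<gamma> \<and> ndom \<gamma> = u \<and> ncod \<gamma> = u') \<and>
    whisker_left (Cat E) f \<gamma> = \<beta> \<and> whisker_right (Cat E) \<gamma> s = \<alpha>"
proof -
  let ?B = "fcod s" and ?X = "fdom f" and ?Y = "fcod f"
  note [simp] = f s a b u u'
  have ab1: "far f \<cdot> ncom \<alpha> = ncom \<beta> \<cdot> fob s"
    using ab by (simp add: whisker_left_Cat whisker_right_Cat)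
  have fu0: "fob (ndom \<beta>) = fob f \<cdot> fob u" "fob (ncod \<beta>) = fob f \<cdot> fob u'"
    and fu1: "far (ndom \<beta>) = far f \<cdot> far u" "far (ncod \<beta>) = far f \<cdot> far u'"
    and us0: "fob (ndom \<alpha>) = fob u \<cdot> fob s" "fob (ncod \<alpha>) = fob u' \<cdot> fob s"
    by (simp_all add: fu[symmetric] us[symmetric] ifun_cmp_def)
  obtain c where c [simp]: "c \<in> Arr E" "Dom E c = ob ?B" "Cod E c = ar ?X"
    and fc: "far f \<cdot> c = ncom \<beta>" and dc [simp]: "d0 ?X \<cdot> c = fob u'" "d1 ?X \<cdot> c = fob u"
    by (rule fully_faithful_lift[OF f ff refl refl, of "fob u'" "fob u" "ncom \<beta>"]) (simp_all add: fu0)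
  have dc_cmp [simp]: "d0 ?X \<cdot> (c \<cdot> x) = fob u' \<cdot> x" "d1 ?X \<cdot> (c \<cdot> x) = fob u \<cdot> x"
    if "x \<in> Arr E" "Cod E x = ob ?B" for x
    using that by (simp_all add: cmp_reassoc[OF dc(1)] cmp_reassoc[OF dc(2)])
  have fc_cmp: "far f \<cdot> (c \<cdot> x) = ncom \<beta> \<cdot> x" if "x \<in> Arr E" "Cod E x = ob ?B" for x
    using that by (simp add: cmp_reassoc[OF fc])
  let ?c = "\<lparr> ndom = u, ncod = u', ncom = c \<rparr>"
  have nat: "icmp E ?X (c \<cdot> d0 ?B) (far u) = icmp E ?X (far u') (c \<cdot> d1 ?B)"
    using inat_natural_arr[OF b(1)]
    by - (rule fully_faithful_eqI[OF f ff refl], simp_all add: fc_cmp fu1)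
  have c_nat: "internal_nat E ?c"
    by (rule internal_natI[where A = ?B and B = ?X]) (simp_all add: nat)
  have left: "whisker_left (Cat E) f ?c = \<beta>"
    using fu fc by (simp add: whisker_left_Cat c_nat)
  have "c \<cdot> fob s = ncom \<alpha>"
    by (rule fully_faithful_eqI[OF f ff refl]) (simp_all add: fc_cmp ab1 us0)
  then have right: "whisker_right (Cat E) ?c s = \<alpha>"
    using us by (simp add: whisker_right_Cat c_nat)
  have unique: "\<gamma> = ?c" if g: "internal_nat E \<gamma>" "ndom \<gamma> = u" "ncod \<gamma> = u'" "whisker_left (Cat E) f \<gamma> = \<beta>" for \<gamma>
  proof -
    have fg: "far f \<cdot> ncom \<gamma> = ncom \<beta>" using g(4)[symmetric] g(1-3) by (simp add: whisker_left_Cat)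
    have "ncom \<gamma> = c"
      using inat_arr(1-5)[OF g(1)] g(2,3)
      by - (rule fully_faithful_eqI[OF f ff refl], simp_all add: fg fc)
    then show ?thesis using g by (intro inat.equality) simp_all
  qed
  show ?thesis
  proof (rule ex1I[of _ ?c])
    show "(internal_nat E ?c \<and> ndom ?c = u \<and> ncod ?c = u') \<and>
        whisker_left (Cat E) f ?c = \<beta> \<and> whisker_right (Cat E) ?c s = \<alpha>"
      using c_nat left right by simp
  qed (use unique in blast)
qed

lemma two_orthogonal_Cat:
  assumes s: "internal_functor E s" and f: "internal_functor E f" and ff: "fully_faithful E f"
    and orth: "orthogonal E (fob s) (fob f)"
  shows "two_orthogonal (Cat E) s f"
proof -
  have One: "hom (One (Cat E)) A B = {f. internal_functor E f \<and> fdom f = A \<and> fcod f = B}"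
    and Vert: "hom (Vert (Cat E)) g h = {\<alpha>. internal_nat E \<alpha> \<and> ndom \<alpha> = g \<and> ncod \<alpha> = h}"
    and sel: "Dom (One (Cat E)) = fdom" "Cod (One (Cat E)) = fcod" "Cmp (One (Cat E)) = ifun_cmp E" for A B g h
    by (auto simp: Cat_def hom_def)
  show ?thesis
    unfolding two_orthogonal_def Let_def One Vert sel
    using orthogonal_Cat[OF assms] fully_faithful_nat_ex1[OF f ff s] by auto
qed

section \<open>Full images and factorisations\<close>

text \<open>The arrows of the full image \<open>C\<close> of \<open>c : C\<^sub>0 \<rightarrow> B\<^sub>0\<close> are the pairs of objects of \<open>C\<close> together
  with an arrow of \<open>B\<close> between their images; its structure maps are lifted along the pullback
  projection \<open>p\<close> to the arrows of \<open>B\<close>.\<close>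

lemma full_image:
  assumes B: "internal_category E B" and c: "c \<in> Arr E" "Cod E c = ob B"
  obtains r where "internal_functor E r" "fully_faithful E r" "fcod r = B" "fob r = c"
proof -
  let ?O = "Dom E c"
  note [simp] = B c
  have "\<exists>p q. is_pullback E (pr_pair E (d0 B) (d1 B)) (pr_map E c c) p q"
    using pullbacks by (simp add: has_pullbacks_def)
  then obtain p q where pb: "is_pullback E (pr_pair E (d0 B) (d1 B)) (pr_map E c c) p q" by blast
  then have p [simp]: "p \<in> Arr E" "Cod E p = ar B" and q [simp]: "q \<in> Arr E" "Cod E q = pr_obj E ?O ?O" "Dom E q = Dom E p"
    and comm: "pr_pair E (d0 B) (d1 B) \<cdot> p = pr_map E c c \<cdot> q"
    by (auto simp: is_pullback_def)
  \<comment> \<open>\<open>s\<close> will be the target map and \<open>t\<close> the source map, in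
    the order of \<open>pr_pair E (d0 B) (d1 B)\<close>.\<close>
  define s where "s = pr1 E ?O ?O \<cdot> q"
  define t where "t = pr2 E ?O ?O \<cdot> q"
  have st [simp]: "s \<in> Arr E" "Dom E s = Dom E p" "Cod E s = ?O" "t \<in> Arr E" "Dom E t = Dom E p" "Cod E t = ?O"
    by (simp_all add: s_def t_def)
  have q_eq: "q = pr_pair E s t" by (simp add: s_def t_def pr_pair_eta)
  have dp [simp]: "d0 B \<cdot> p = c \<cdot> s" "d1 B \<cdot> p = c \<cdot> t"
    using comm by (simp_all add: q_eq pr_pair_cmp pr_map_cmp_pair pr_pair_eq_iff)
  have ff: "\<forall>x\<in>Arr E. \<forall>y\<in>Arr E. \<forall>h\<in>Arr E. Dom E x = Dom E h \<longrightarrow> Dom E y = Dom E h \<longrightarrow>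
      Cod E x = Dom E c \<longrightarrow> Cod E y = Dom E c \<longrightarrow> Cod E h = ar B \<longrightarrow>
      d0 B \<cdot> h = c \<cdot> x \<longrightarrow> d1 B \<cdot> h = c \<cdot> y \<longrightarrow>
      (\<exists>!u. u \<in> hom E (Dom E h) (Dom E p) \<and> p \<cdot> u = h \<and> s \<cdot> u = x \<and> t \<cdot> u = y)"
    using pb unfolding q_eq by (subst (asm) is_pullback_pair_iff) simp_all
  have dp_cmp [simp]: "d0 B \<cdot> (p \<cdot> x) = c \<cdot> (s \<cdot> x)" "d1 B \<cdot> (p \<cdot> x) = c \<cdot> (t \<cdot> x)"
    if "x \<in> Arr E" "Cod E x = Dom E p" for x
    using that by (simp_all add: cmp_reassoc[OF dp(1)] cmp_reassoc[OF dp(2)])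
  have lift: "\<exists>u. u \<in> Arr E \<and> Dom E u = Dom E h \<and> Cod E u = Dom E p \<and> p \<cdot> u = h \<and> s \<cdot> u = x \<and> t \<cdot> u = y"
    if "x \<in> Arr E" "y \<in> Arr E" "h \<in> Arr E" "Dom E x = Dom E h" "Dom E y = Dom E h"
      "Cod E x = ?O" "Cod E y = ?O" "Cod E h = ar B" "d0 B \<cdot> h = c \<cdot> x" "d1 B \<cdot> h = c \<cdot> y" for x y h
    using ff[rule_format, of x y h] that by (auto simp: hom_def)
  have eqI: "u = v" if "u \<in> Arr E" "v \<in> Arr E" "Dom E u = Dom E v" "Cod E u = Dom E p" "Cod E v = Dom E p"
    "p \<cdot> u = p \<cdot> v" "s \<cdot> u = s \<cdot> v" "t \<cdot> u = t \<cdot> v" for u v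
    using ff[rule_format, of "s \<cdot> v" "t \<cdot> v" "p \<cdot> v"] that unfolding hom_def by auto
  \<comment> \<open>Identities: both ends are the given object, and the arrow below is the identity
    of \<open>B\<close> at its image.\<close>
  obtain e where e [simp]: "e \<in> Arr E" "Dom E e = ?O" "Cod E e = Dom E p" "p \<cdot> e = idm B \<cdot> c"
    "s \<cdot> e = Idn E ?O" "t \<cdot> e = Idn E ?O"
    using lift[of "Idn E ?O" "Idn E ?O" "idm B \<cdot> c"] by auto
  have e_cmp [simp]: "p \<cdot> (e \<cdot> x) = idm B \<cdot> (c \<cdot> x)" "s \<cdot> (e \<cdot> x) = x" "t \<cdot> (e \<cdot> x) = x"
    if "x \<in> Arr E" "Cod E x = ?O" for x
    using that by (simp_all add: cmp_reassoc[OF e(4)] cmp_reassoc[OF e(5)] cmp_reassoc[OF e(6)])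
  let ?p1 = "pb1 E t s" and ?p2 = "pb2 E t s"
  have ts: "t \<in> Arr E" "s \<in> Arr E" "Cod E t = Cod E s" by simp_all
  note pb_ts [simp] = pb_arr[OF ts, simplified]
  \<comment> \<open>Composition: the outer ends of the pair, over the composite in \<open>B\<close>
    of the two images.\<close>
  obtain m where m [simp]: "m \<in> Arr E" "Dom E m = pb_obj E t s" "Cod E m = Dom E p"
    "p \<cdot> m = icmp E B (p \<cdot> ?p1) (p \<cdot> ?p2)" "s \<cdot> m = s \<cdot> ?p1" "t \<cdot> m = t \<cdot> ?p2"
    using lift[of "s \<cdot> ?p1" "t \<cdot> ?p2" "icmp E B (p \<cdot> ?p1) (p \<cdot> ?p2)"] by auto
  have m_cmp [simp]: "p \<cdot> (m \<cdot> x) = icmp E B (p \<cdot> ?p1) (p \<cdot> ?p2) \<cdot> x"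
    "s \<cdot> (m \<cdot> x) = s \<cdot> (?p1 \<cdot> x)" "t \<cdot> (m \<cdot> x) = t \<cdot> (?p2 \<cdot> x)"
    if "x \<in> Arr E" "Cod E x = pb_obj E t s" for x
    using that by (simp_all add: cmp_reassoc[OF m(4)] cmp_reassoc[OF m(5)] cmp_reassoc[OF m(6)] del: icmp_cmp)
  have tp1: "t \<cdot> (?p1 \<cdot> x) = s \<cdot> (?p2 \<cdot> x)" if "x \<in> Arr E" "Cod E x = pb_obj E t s" for x
    using that by (simp add: cmp_reassoc[OF pb_ts(7)])
  define C where "C = \<lparr> ob = ?O, ar = Dom E p, d0 = s, d1 = t, idm = e, mul = m \<rparr>"
  have C_sel [simp]: "ob C = ?O" "ar C = Dom E p" "d0 C = s" "d1 C = t" "idm C = e" "mul C = m"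
    by (simp_all add: C_def)
  \<comment> \<open>\<open>icmp_arr\<close> presupposes an internal category, which \<open>C\<close>
    is not yet known to be. These facts about its composites come directly from the pullback of
    \<open>t\<close> and \<open>s\<close>.\<close>
  have icmp_C [simp]: "icmp E C h g \<in> Arr E" "Dom E (icmp E C h g) = Dom E g" "Cod E (icmp E C h g) = Dom E p"
      "p \<cdot> icmp E C h g = icmp E B (p \<cdot> h) (p \<cdot> g)" "s \<cdot> icmp E C h g = s \<cdot> h" "t \<cdot> icmp E C h g = t \<cdot> g"
    if "h \<in> Arr E" "g \<in> Arr E" "Cod E h = Dom E p" "Cod E g = Dom E p" "Dom E h = Dom E g" "t \<cdot> h = s \<cdot> g" for h g
  proof -
    have "Cod E h = Dom E t" "Cod E g = Dom E s" using that by simp_all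
    note hg = pb_pair_arr[OF ts that(1,2) this that(5,6)]
    show "icmp E C h g \<in> Arr E" "Dom E (icmp E C h g) = Dom E g" "Cod E (icmp E C h g) = Dom E p"
      "p \<cdot> icmp E C h g = icmp E B (p \<cdot> h) (p \<cdot> g)" "s \<cdot> icmp E C h g = s \<cdot> h" "t \<cdot> icmp E C h g = t \<cdot> g"
      using hg that by (simp_all add: icmp_def[of E C] tp1)
  qed
  have "internal_category E C"
  proof -
    let ?r = "pb1 E (t \<cdot> ?p2) s" and ?t = "pb2 E (t \<cdot> ?p2) s"
    have p2: "t \<cdot> ?p2 \<in> Arr E" "s \<in> Arr E" "Cod E (t \<cdot> ?p2) = Cod E s" by simp_all
    note r = pb_arr[OF p2, simplified]
    \<comment> \<open>By \<open>eqI\<close> each law splits into two equations between ends and one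
      in \<open>B\<close>, where it is the corresponding law of \<open>B\<close>.\<close>
    have "icmp E C (e \<cdot> s) (Idn E (Dom E p)) = Idn E (Dom E p)"
      by (rule eqI) simp_all
    moreover have "icmp E C (Idn E (Dom E p)) (e \<cdot> t) = Idn E (Dom E p)"
      by (rule eqI) simp_all
    moreover have "icmp E C (m \<cdot> ?r) ?t = icmp E C (?p1 \<cdot> ?r) (icmp E C (?p2 \<cdot> ?r) ?t)"
      using r by - (rule eqI, simp_all add: tp1)
    ultimately show ?thesis
      unfolding internal_category_def Let_def hom_def by simp
  qed
  note C = this
  define r where "r = \<lparr> fdom = C, fcod = B, fob = c, far = p \<rparr>"
  have r_sel [simp]: "fdom r = C" "fcod r = B" "fob r = c" "far r = p" by (simp_all add: r_def)
  have r: "internal_functor E r"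
    by (rule internal_functorI) (simp_all add: C hom_def)
  moreover have "fully_faithful E r"
    using ff by (simp add: fully_faithful_iff[OF r])
  ultimately show ?thesis using that by simp
qed

section \<open>Composites and isomorphisms; factorising a functor\<close>

lemma fully_faithful_cmp:
  assumes f: "internal_functor E f" "fully_faithful E f" and g: "internal_functor E g" "fully_faithful E g"
    and eq: "fcod f = fdom g"
  shows "fully_faithful E (ifun_cmp E g f)"
proof -
  let ?A = "fdom f" and ?B = "fdom g" and ?C = "fcod g"
  note [simp] = f(1) g(1) eq
  have gf: "internal_functor E (ifun_cmp E g f)" by (simp add: internal_functor_cmp)
  have "\<exists>!u. u \<in> hom E (Dom E h) (ar ?A) \<and> (far g \<cdot> far f) \<cdot> u = h \<and> d0 ?A \<cdot> u = x \<and> d1 ?A \<cdot> u = y"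
    if xyh [simp]: "x \<in> Arr E" "y \<in> Arr E" "h \<in> Arr E" "Dom E x = Dom E h" "Dom E y = Dom E h"
      "Cod E x = ob ?A" "Cod E y = ob ?A" "Cod E h = ar ?C"
      and d: "d0 ?C \<cdot> h = (fob g \<cdot> fob f) \<cdot> x" "d1 ?C \<cdot> h = (fob g \<cdot> fob f) \<cdot> y" for x y h
  proof -
    \<comment> \<open>The lift is made in two stages, first along \<open>g\<close> between the
      images of \<open>x\<close> and \<open>y\<close>, then along \<open>f\<close>; uniqueness
      cancels \<open>g\<close> and \<open>f\<close> in the same order.\<close>
    obtain v where v [simp]: "v \<in> Arr E" "Dom E v = Dom E h" "Cod E v = ar ?B" "far g \<cdot> v = h"
      "d0 ?B \<cdot> v = fob f \<cdot> x" "d1 ?B \<cdot> v = fob f \<cdot> y"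
      by (rule fully_faithful_lift[OF g refl refl, of "fob f \<cdot> x" "fob f \<cdot> y" h]) (simp_all add: d)
    obtain u where u [simp]: "u \<in> Arr E" "Dom E u = Dom E v" "Cod E u = ar ?A" "far f \<cdot> u = v"
      "d0 ?A \<cdot> u = x" "d1 ?A \<cdot> u = y"
      by (rule fully_faithful_lift[OF f refl eq, of x y v]) simp_all
    show ?thesis
    proof (rule ex1I[of _ u])
      show "u \<in> hom E (Dom E h) (ar ?A) \<and> (far g \<cdot> far f) \<cdot> u = h \<and> d0 ?A \<cdot> u = x \<and> d1 ?A \<cdot> u = y"
        by (simp add: hom_def)
    next
      fix w assume "w \<in> hom E (Dom E h) (ar ?A) \<and> (far g \<cdot> far f) \<cdot> w = h \<and> d0 ?A \<cdot> w = x \<and> d1 ?A \<cdot> w = y"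
      then have w: "w \<in> Arr E" "Dom E w = Dom E h" "Cod E w = ar ?A" "far g \<cdot> (far f \<cdot> w) = h" "d0 ?A \<cdot> w = x" "d1 ?A \<cdot> w = y"
        by (auto simp: hom_def)
      have "far f \<cdot> w = far f \<cdot> u"
        using w by - (rule fully_faithful_eqI[OF g refl], simp_all)
      then show "w = u"
        using w by - (rule fully_faithful_eqI[OF f refl], simp_all)
    qed
  qed
  then show ?thesis
    unfolding fully_faithful_iff[OF gf] by (simp add: ifun_cmp_def)
qed

lemma is_iso_Cat:
  assumes "is_iso (One (Cat E)) f"
  obtains g where "internal_functor E f" "internal_functor E g" "fdom g = fcod f" "fcod g = fdom f"
    "fob g \<cdot> fob f = Idn E (ob (fdom f))" "fob f \<cdot> fob g = Idn E (ob (fcod f))"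
    "far g \<cdot> far f = Idn E (ar (fdom f))" "far f \<cdot> far g = Idn E (ar (fcod f))"
proof -
  obtain g where "internal_functor E f" "internal_functor E g" "fdom g = fcod f" "fcod g = fdom f"
    "ifun_cmp E g f = ifun_id E (fdom f)" "ifun_cmp E f g = ifun_id E (fcod f)"
    using assms by (auto simp: is_iso_def Cat_def hom_def)
  then show ?thesis using that[of g] by (simp add: ifun_cmp_def ifun_id_def)
qed

lemma is_iso_fob:
  assumes "is_iso (One (Cat E)) f"
  shows "internal_functor E f" "is_iso E (fob f)"
proof -
  obtain g where g: "internal_functor E f" "internal_functor E g" "fdom g = fcod f" "fcod g = fdom f"
    "fob g \<cdot> fob f = Idn E (ob (fdom f))" "fob f \<cdot> fob g = Idn E (ob (fcod f))"
    by (rule is_iso_Cat[OF assms])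
  then show "internal_functor E f" "is_iso E (fob f)"
    by (auto simp: is_iso_def hom_def intro!: exI[of _ "fob g"])
qed

text \<open>The unique lift of \<open>h\<close> is \<open>far g \<cdot> h\<close> for the inverse
  \<open>g\<close>; its ends are \<open>x\<close> and \<open>y\<close> because \<open>fob g\<close>
  undoes \<open>fob f\<close>.\<close>

lemma fully_faithful_iso:
  assumes "is_iso (One (Cat E)) f"
  shows "fully_faithful E f"
proof -
  let ?A = "fdom f" and ?B = "fcod f"
  obtain g where [simp]: "internal_functor E f" "internal_functor E g" "fdom g = ?B" "fcod g = ?A"
    and gf0: "fob g \<cdot> fob f = Idn E (ob ?A)" and gf: "far g \<cdot> far f = Idn E (ar ?A)" and fg: "far f \<cdot> far g = Idn E (ar ?B)"
    by (rule is_iso_Cat[OF assms])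
  have gf0_cmp: "fob g \<cdot> (fob f \<cdot> x) = x" if "x \<in> Arr E" "Cod E x = ob ?A" for x
    using that by (simp add: cmp_reassoc[OF gf0])
  have gf_cmp: "far g \<cdot> (far f \<cdot> x) = x" if "x \<in> Arr E" "Cod E x = ar ?A" for x
    using that by (simp add: cmp_reassoc[OF gf])
  have fg_cmp: "far f \<cdot> (far g \<cdot> x) = x" if "x \<in> Arr E" "Cod E x = ar ?B" for x
    using that by (simp add: cmp_reassoc[OF fg])
  have "\<exists>!u. u \<in> hom E (Dom E h) (ar ?A) \<and> far f \<cdot> u = h \<and> d0 ?A \<cdot> u = x \<and> d1 ?A \<cdot> u = y"
    if "x \<in> Arr E" "y \<in> Arr E" "h \<in> Arr E" "Dom E x = Dom E h" "Dom E y = Dom E h"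
      "Cod E x = ob ?A" "Cod E y = ob ?A" "Cod E h = ar ?B"
      "d0 ?B \<cdot> h = fob f \<cdot> x" "d1 ?B \<cdot> h = fob f \<cdot> y" for x y h
  proof (rule ex1I[of _ "far g \<cdot> h"])
    show "far g \<cdot> h \<in> hom E (Dom E h) (ar ?A) \<and> far f \<cdot> (far g \<cdot> h) = h \<and>
        d0 ?A \<cdot> (far g \<cdot> h) = x \<and> d1 ?A \<cdot> (far g \<cdot> h) = y"
      using that by (simp add: hom_def fg_cmp gf0_cmp)
  next
    fix u assume "u \<in> hom E (Dom E h) (ar ?A) \<and> far f \<cdot> u = h \<and> d0 ?A \<cdot> u = x \<and> d1 ?A \<cdot> u = y"
    then show "u = far g \<cdot> h" using gf_cmp[of u] by (auto simp: hom_def)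
  qed
  then show ?thesis by (simp add: fully_faithful_iff)
qed

lemma Cat_factorisation:
  assumes f: "internal_functor E f"
    and lr: "l0 \<in> hom E (ob (fdom f)) Z" "r0 \<in> hom E Z (ob (fcod f))" "fob f = r0 \<cdot> l0"
  obtains l r where "internal_functor E l" "internal_functor E r" "fully_faithful E r"
    "fdom l = fdom f" "fcod l = fdom r" "fcod r = fcod f" "fob l = l0" "fob r = r0" "f = ifun_cmp E r l"
proof -
  obtain r where r: "internal_functor E r" "fully_faithful E r" "fcod r = fcod f" "fob r = r0"
    using full_image[of "fcod f" r0] f lr by (auto simp: hom_def)
  \<comment> \<open>\<open>full_image\<close> leaves the domain of \<open>r\<close> abstract; its
    object of objects is read off as the domain of \<open>fob r\<close>.\<close>
  have Z: "ob (fdom r) = Z" using ifun_arr(2)[OF r(1)] r(4) lr(2) by (simp add: hom_def)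
  obtain l where "internal_functor E l" "fdom l = fdom f" "fcod l = fdom r" "fob l = l0" "ifun_cmp E r l = f"
    by (rule fully_faithful_functor_lift[OF r(1,2) f r(3)[symmetric], of l0])
      (use lr r(4) Z in \<open>simp_all add: hom_def\<close>)
  then show ?thesis using that r by metis
qed

end

theorem proposition8p7:
  fixes E :: "('o, 'a) cat" and L R :: "'a set"
  assumes "category E"
    and "has_pullbacks E"
    and "has_finite_products E"
    and "orthogonal_factorisation_system E L R"
  shows "two_orthogonal_factorisation_system (Cat E)
    (on_objects E L) {f \<in> on_objects E R. fully_faithful E f}"
proof -
  interpret category_with_limits E
    using assms by (simp add: category_with_limits_def category_with_limits_axioms_def)
  interpret E: orthogonal_factorisation_system E L R by fact
  let ?L = "on_objects E L" and ?R = "{f \<in> on_objects E R. fully_faithful E f}"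
  have sel: "Arr (One (Cat E)) = {f. internal_functor E f}" "Dom (One (Cat E)) = fdom"
    "Cod (One (Cat E)) = fcod" "Cmp (One (Cat E)) = ifun_cmp E"
    by (simp_all add: Cat_def)
  \<comment> \<open>Composition of functors is composition in \<open>E\<close> on objects, so
    closure passes along \<open>fob\<close>; \<open>S\<close> stands for \<open>L\<close> and
    \<open>R\<close> in turn.\<close>
  have comp: "fob g \<cdot>\<^bsub>E\<^esub> fob f \<in> S"
    if "closed_under_comp E S" "fob f \<in> S" "fob g \<in> S" "internal_functor E f" "internal_functor E g" "fcod f = fdom g"
    for S f g
    using that by (simp add: closed_under_comp_def)
  show ?thesis
  proof (intro two_orthogonal_factorisation_system.intro two_orthogonal_factorisation_system_axioms.intro)
    show "two_category (Cat E)" by (rule two_category_Cat)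
    show "?L \<subseteq> Arr (One (Cat E))" "?R \<subseteq> Arr (One (Cat E))"
      by (auto simp: on_objects_def sel)
    show "contains_isos (One (Cat E)) ?L"
      using is_iso_fob E.L_isos by (auto simp: contains_isos_def on_objects_def)
    show "contains_isos (One (Cat E)) ?R"
      using is_iso_fob fully_faithful_iso E.R_isos by (auto simp: contains_isos_def on_objects_def)
    show "closed_under_comp (One (Cat E)) ?L"
      unfolding closed_under_comp_def on_objects_def sel
      using internal_functor_cmp comp[OF E.L_comp] by (simp add: ifun_cmp_def)
    show "closed_under_comp (One (Cat E)) ?R"
      unfolding closed_under_comp_def on_objects_def sel
      using internal_functor_cmp fully_faithful_cmp comp[OF E.R_comp] by (simp add: ifun_cmp_def)
    show "two_orthogonal (Cat E) s f" if "s \<in> ?L" "f \<in> ?R" for s f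
      using that by (auto simp: on_objects_def intro: two_orthogonal_Cat E.orth)
    show "has_factorisations (One (Cat E)) ?L ?R"
      unfolding has_factorisations_def sel
    proof
      fix f assume "f \<in> {f. internal_functor E f}"
      then have f: "internal_functor E f" by simp
      obtain l0 r0 where l0: "l0 \<in> L" and r0: "r0 \<in> R"
        and lr: "Dom E l0 = Dom E (fob f)" "Cod E l0 = Dom E r0" "Cod E r0 = Cod E (fob f)" "fob f = r0 \<cdot>\<^bsub>E\<^esub> l0"
        using E.factorisation ifun_arr(1)[OF f] unfolding has_factorisations_def by blast
      have "l0 \<in> hom E (ob (fdom f)) (Dom E r0)" "r0 \<in> hom E (Dom E r0) (ob (fcod f))"
        using l0 r0 lr(1-3) E.L_arr E.R_arr f by (auto simp: hom_def)
      then obtain l r where "internal_functor E l" "internal_functor E r" "fully_faithful E r"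
        "fdom l = fdom f" "fcod l = fdom r" "fcod r = fcod f" "fob l = l0" "fob r = r0" "f = ifun_cmp E r l"
        by (rule Cat_factorisation[OF f _ _ lr(4)])
      then show "\<exists>l\<in>?L. \<exists>r\<in>?R. fdom l = fdom f \<and> fcod l = fdom r \<and> fcod r = fcod f \<and> f = ifun_cmp E r l"
        using l0 r0 by (intro bexI[of _ l] bexI[of _ r]) (simp_all add: on_objects_def)
    qed
  qed
qed

end
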